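(* Let $G:\mathcal T\to\mathbb R$ be a bounded Borel-measurable function. The Cauchy problem for the nonlinear wave equation $$\left(\frac{\partial}{\partial t}-\frac{\partial}{\partial x}\right)g(x,t)=-\delta(x)\,\mathrm{sign}\,g(0,t),\qquad g(x,0)=G(x),$$ possesses a unique bounded solution for $t\ge0$. Moreover, the functions $\phi(t)=g(0,t)$ and $u(t)=-\mathrm{sign}\,g(0,t)$ form the unique solution of the functional equation $$\phi(t)-\frac12u(t)-\sum_{k\in\mathbb Z,\ k\ne0,\ 2k\pi\in[-t,0]}u(t+2k\pi)=G(t),\qquad -u(t)\in\mathrm{sign}\,\phi(t),\qquad t\ge0,$$ where $G$ is regarded as a $2\pi$-periodic function on $\mathbb R$.
   Context: $\mathcal T=\mathbb R/2\pi\mathbb Z$ and $\delta$ is the Dirac delta at $0\in\mathcal T$. The function $\mathrm{sign}$ is multivalued: $\mathrm{sign}(y)=\{y/|y|\}$ for $y\ne0$ and $\mathrm{sign}(0)=[-1,1]$. A bounded solution is a bounded measurable function $g$ on $\mathcal T\times[0,\infty)$ together with a measurable $u:[0,\infty)\to[-1,1]$ such that $t\mapsto g(\cdot,t)$ is continuous as a map into distributions on $\mathcal T$, $g(\cdot,0)=G$, the equation $\left(\frac{\partial}{\partial t}-\frac{\partial}{\partial x}\right)g=\delta(x)u(t)$ holds in the sense of distributions, and $-u(t)\in\mathrm{sign}\,g(0,t)$ for a.e. $t$. Here the value $g(0,t)$ is understood in the averaged sense $g(0,t)=\lim_{\epsilon\to0}\frac1{2\epsilon}\int_{-\epsilon}^{\epsilon}g(x,t)\,dx$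 (which exists for a.e. $t$). Functions are identified if they coincide almost everywhere, and the functional equation is understood for almost every $t$. *)

theory Defs
  imports "HOL-Analysis.Analysis"
begin

text \<open>
  Functions on the circle of length $2\pi$ are represented by $2\pi$-periodic functions on the
  real line, and functions on a half line $t \ge 0$ by total functions that are only ever
  inspected for $t \ge 0$.
\<close>

definition circle_function :: "(real \<Rightarrow> 'a) \<Rightarrow> bool" where
  "circle_function f \<longleftrightarrow> (\<forall>x. f (x + 2 * pi) = f x)"

primrec k_smooth :: "nat \<Rightarrow> ('a::real_normed_vector \<Rightarrow> 'b::real_normed_vector) \<Rightarrow> bool" where
  "k_smooth 0 f \<longleftrightarrow> continuous_on UNIV f"
| "k_smooth (Suc n) f \<longleftrightarrow>
     (\<forall>x. f differentiable (at x)) \<and> (\<forall>v. k_smooth n (\<lambda>x. frechet_derivative f (at x) v))"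

definition smooth :: "('a::real_normed_vector \<Rightarrow> 'b::real_normed_vector) \<Rightarrow> bool" where
  "smooth f \<longleftrightarrow> (\<forall>n. k_smooth n f)"

definition circle_test_function :: "(real \<Rightarrow> real) \<Rightarrow> bool" where
  "circle_test_function \<psi> \<longleftrightarrow> smooth \<psi> \<and> circle_function \<psi>"

text \<open>Test functions on the product of the circle (first component) and the open half line $t > 0$.\<close>

definition cylinder_test_function :: "(real \<times> real \<Rightarrow> real) \<Rightarrow> bool" where
  "cylinder_test_function \<psi> \<longleftrightarrow>
     smooth \<psi> \<and> (\<forall>t. circle_function (\<lambda>x. \<psi> (x, t))) \<and>
     (\<exists>a b. 0 < a \<and> (\<forall>x t. t \<notin> {a..b} \<longrightarrow> \<psi> (x, t) = 0))"

text \<open>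
  Continuity into distributions on the circle refers to the topology of convergence on every test
  function. On a metrizable parameter space this agrees with continuity for the strong topology.
\<close>

definition continuous_into_distributions :: "(real \<Rightarrow> real \<Rightarrow> real) \<Rightarrow> bool" where
  "continuous_into_distributions g \<longleftrightarrow>
     (\<forall>\<psi>. circle_test_function \<psi> \<longrightarrow>
        continuous_on {0..} (\<lambda>t. LINT x:{0..2 * pi}|lborel. g x t * \<psi> x))"

text \<open>
  $(\partial_t - \partial_x) g = \delta(x)\, u(t)$ tested against \<open>\<psi>\<close>: both derivatives are moved
  to \<open>\<psi>\<close> with a change of sign.
\<close>

definition wave_equation :: "(real \<Rightarrow> real \<Rightarrow> real) \<Rightarrow> (real \<Rightarrow> real) \<Rightarrow> bool" where
  "wave_equation g u \<longleftrightarrow>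
     (\<forall>\<psi>. cylinder_test_function \<psi> \<longrightarrow>
        (LINT (x, t):{0..2 * pi} \<times> {0..}|lborel.
           g x t * (- deriv (\<lambda>s. \<psi> (x, s)) t + deriv (\<lambda>y. \<psi> (y, t)) x))
        = (LINT t:{0..}|lborel. u t * \<psi> (0, t)))"

definition multi_sign :: "real \<Rightarrow> real set" where
  "multi_sign y = (if y = 0 then {-1..1} else {y / \<bar>y\<bar>})"

definition symmetric_mean :: "(real \<Rightarrow> real) \<Rightarrow> real \<Rightarrow> real" where
  "symmetric_mean h \<epsilon> = 1 / (2 * \<epsilon>) * (LINT x:{-\<epsilon>..\<epsilon>}|lborel. h x)"

text \<open>
  The value $g(0,t)$ in the averaged sense. Since \<open>Lim\<close> is unspecified where the means do not
  converge, convergence for almost every $t$ has to be stated separately.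
\<close>

definition value_at_0 :: "(real \<Rightarrow> real \<Rightarrow> real) \<Rightarrow> real \<Rightarrow> real" where
  "value_at_0 g t = Lim (at_right 0) (symmetric_mean (\<lambda>x. g x t))"

definition value_at_0_exists :: "(real \<Rightarrow> real \<Rightarrow> real) \<Rightarrow> real \<Rightarrow> bool" where
  "value_at_0_exists g t \<longleftrightarrow>
     (symmetric_mean (\<lambda>x. g x t) \<longlongrightarrow> value_at_0 g t) (at_right 0)"

text \<open>
  Functions are identified if they coincide almost everywhere; \<open>g\<close> and \<open>u\<close> are Borel
  representatives of their classes. The joint Borel measurability of \<open>g\<close> makes every slice
  $g(\cdot,t)$ measurable.
\<close>

definition bounded_solution ::
  "(real \<Rightarrow> real) \<Rightarrow> (real \<Rightarrow> real \<Rightarrow> real) \<Rightarrow> (real \<Rightarrow> real) \<Rightarrow> bool" where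
  "bounded_solution G g u \<longleftrightarrow>
     (\<forall>t\<ge>0. circle_function (\<lambda>x. g x t)) \<and>
     set_borel_measurable borel (UNIV \<times> {0..}) (\<lambda>(x, t). g x t) \<and>
     (\<exists>C. \<forall>x. \<forall>t\<ge>0. \<bar>g x t\<bar> \<le> C) \<and>
     set_borel_measurable borel {0..} u \<and>
     (\<forall>t\<ge>0. u t \<in> {-1..1}) \<and>
     continuous_into_distributions g \<and>
     (AE x in lborel. g x 0 = G x) \<and>
     wave_equation g u \<and>
     (AE t in lborel. t \<ge> 0 \<longrightarrow> - u t \<in> multi_sign (value_at_0 g t))"

text \<open>
  No measurability is imposed on \<open>\<phi>\<close> and \<open>u\<close>, which makes uniqueness only stronger.
\<close>

definition functional_equation ::
  "(real \<Rightarrow> real) \<Rightarrow> (real \<Rightarrow> real) \<Rightarrow> (real \<Rightarrow> real) \<Rightarrow> bool" where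
  "functional_equation G \<phi> u \<longleftrightarrow>
     (AE t in lborel. t \<ge> 0 \<longrightarrow>
        \<phi> t - 1 / 2 * u t
          - (\<Sum>k\<in>{k::int. k \<noteq> 0 \<and> 2 * of_int k * pi \<in> {-t..0}}. u (t + 2 * of_int k * pi))
          = G t \<and>
        - u t \<in> multi_sign (\<phi> t))"

end

theory Submission
  imports Defs
begin

text \<open>
  Away from \<open>x = 0\<close> the equation transports \<open>g\<close> along the lines on which \<open>x + t\<close> is constant, so on
  the fundamental domain $0 \le x < 2\pi$ a solution has the form $g(x,t) = K(x+t)$ for a profile
  \<open>K\<close> on the half line. The initial condition says $K = G$ on $[0, 2\pi)$, and the source
  $\delta(x) u(t)$ says that the trace from the left of the origin, which is $K(t + 2\pi)$, exceeds
  the trace from the right, which is $K(t)$, by \<open>u\<close>: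
  \[ K(t + 2\pi) = K(t) + u(t), \qquad t \ge 0. \]
  Unwinding this recursion gives $K(t) = G(t) + \sum_{k \ge 1} u(t - 2\pi k)$, the sum in the
  functional equation. At almost every \<open>t\<close> the symmetric means of $g(\cdot, t)$ converge to the
  average of the two traces, $g(0,t) = K(t) + \frac12 u(t)$, which turns the nonlinear boundary
  condition into the functional equation.

  The functional equation can be solved explicitly. Given $c = K(t)$, the conditions
  $\phi - \frac12 u = c$ and $-u \in \mathrm{sign}\,\phi$ have exactly one solution, namely
  $u = -2c$ cut off at $\pm 1$. So \<open>u\<close> and \<open>K\<close> are determined period by period
  (\<open>functional_equation_unique\<close>). The map $c \mapsto c + u$ preserves every interval
  $[-M, M]$ with $M \ge \frac12$, because it reflects \<open>c\<close> if $|c| \le \frac12$ and moves it towards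
  $0$ by one otherwise; hence the profile built from \<open>G\<close> by iterating this map is bounded, and
  it gives a bounded solution (\<open>bounded_solution_exists\<close>).

  Two facts connect the profiles with the distributional formulation. Every profile wave solves the
  wave equation with its own jump as the source (\<open>wave_equation_profile\<close>): after the change of
  variables $y = x + t$, the derivative that falls on the test function is a derivative along the
  characteristics and integrates to boundary terms. Conversely, a solution without source and with
  zero initial data vanishes (\<open>homogeneous_wave_eq_0\<close>): tested against $\psi(x+t)\eta(t)$, the
  equation says that $\int h(x,t)\psi(x+t)\,dx$ has weak time derivative zero, so that it keeps its
  initial value, and the smooth periodic functions \<open>\<psi>\<close> separate bounded functions on the circle.
  Applied to the difference of an arbitrary solution \<open>g\<close> and the profile wave with the same \<open>u\<close>,
  this shows that every solution is a profile wave, and applied to the difference of two solutions it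
  gives uniqueness.
\<close>

section \<open>Calculus of smooth functions\<close>

text \<open>
  The recursion in terms of an arbitrary derivative instead of \<open>frechet_derivative\<close>. All closure
  properties below go by induction through this form.
\<close>

lemma k_smooth_Suc_iff:
  "k_smooth (Suc n) f \<longleftrightarrow>
     (\<exists>f'. (\<forall>x. (f has_derivative f' x) (at x)) \<and> (\<forall>v. k_smooth n (\<lambda>x. f' x v)))"
proof
  assume "k_smooth (Suc n) f"
  then show "\<exists>f'. (\<forall>x. (f has_derivative f' x) (at x)) \<and> (\<forall>v. k_smooth n (\<lambda>x. f' x v))"
    by (intro exI[of _ "\<lambda>x. frechet_derivative f (at x)"])
      (auto simp: frechet_derivative_works[symmetric])
next
  assume "\<exists>f'. (\<forall>x. (f has_derivative f' x) (at x)) \<and> (\<forall>v. k_smooth n (\<lambda>x. f' x v))"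
  then obtain f' where f': "\<And>x. (f has_derivative f' x) (at x)" "\<And>v. k_smooth n (\<lambda>x. f' x v)"
    by auto
  then have "frechet_derivative f (at x) = f' x" for x
    by (metis frechet_derivative_at)
  with f' show "k_smooth (Suc n) f"
    by (auto simp: differentiable_def)
qed

lemma k_smooth_SucI:
  assumes "\<And>x. (f has_derivative f' x) (at x)" "\<And>v. k_smooth n (\<lambda>x. f' x v)"
  shows "k_smooth (Suc n) f"
  unfolding k_smooth_Suc_iff using assms by blast

lemma k_smooth_SucE:
  assumes "k_smooth (Suc n) f"
  obtains f' where "\<And>x. (f has_derivative f' x) (at x)" "\<And>v. k_smooth n (\<lambda>x. f' x v)"
  using assms unfolding k_smooth_Suc_iff by blast

lemma k_smooth_Suc_imp: "k_smooth (Suc n) f \<Longrightarrow> k_smooth n f"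
proof (induction n arbitrary: f)
  case 0
  then show ?case
    by (auto simp: continuous_on_eq_continuous_at differentiable_imp_continuous_within)
next
  case (Suc n)
  from Suc.prems obtain f'
    where f': "\<And>x. (f has_derivative f' x) (at x)" "\<And>v. k_smooth (Suc n) (\<lambda>x. f' x v)"
    by (rule k_smooth_SucE) blast
  show ?case
    by (rule k_smooth_SucI[OF f'(1) Suc.IH[OF f'(2)]])
qed

lemma k_smooth_const: "k_smooth n (\<lambda>x. c)"
proof (induction n arbitrary: c)
  case (Suc n)
  show ?case
    by (rule k_smooth_SucI[where f' = "\<lambda>x v. 0"]) (auto intro: Suc.IH)
qed simp

lemma k_smooth_add: "k_smooth n f \<Longrightarrow> k_smooth n g \<Longrightarrow> k_smooth n (\<lambda>x. f x + g x)"
proof (induction n arbitrary: f g)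
  case 0
  then show ?case by (auto intro!: continuous_intros)
next
  case (Suc n)
  obtain f' where f': "\<And>x. (f has_derivative f' x) (at x)" "\<And>v. k_smooth n (\<lambda>x. f' x v)"
    using Suc.prems(1) by (rule k_smooth_SucE) blast
  obtain g' where g': "\<And>x. (g has_derivative g' x) (at x)" "\<And>v. k_smooth n (\<lambda>x. g' x v)"
    using Suc.prems(2) by (rule k_smooth_SucE) blast
  show ?case
    by (rule k_smooth_SucI[OF has_derivative_add[OF f'(1) g'(1)] Suc.IH[OF f'(2) g'(2)]])
qed

lemma k_smooth_mult:
  fixes f g :: "'a::real_normed_vector \<Rightarrow> real"
  shows "k_smooth n f \<Longrightarrow> k_smooth n g \<Longrightarrow> k_smooth n (\<lambda>x. f x * g x)"
proof (induction n arbitrary: f g)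
  case 0
  then show ?case by (auto intro!: continuous_intros)
next
  case (Suc n)
  obtain f' where f': "\<And>x. (f has_derivative f' x) (at x)" "\<And>v. k_smooth n (\<lambda>x. f' x v)"
    using Suc.prems(1) by (rule k_smooth_SucE) blast
  obtain g' where g': "\<And>x. (g has_derivative g' x) (at x)" "\<And>v. k_smooth n (\<lambda>x. g' x v)"
    using Suc.prems(2) by (rule k_smooth_SucE) blast
  have "k_smooth n (\<lambda>x. f x * g' x v + f' x v * g x)" for v
    by (rule k_smooth_add[OF Suc.IH Suc.IH])
      (rule f' g' k_smooth_Suc_imp[OF Suc.prems(1)] k_smooth_Suc_imp[OF Suc.prems(2)])+
  then show ?case
    by (rule k_smooth_SucI[OF has_derivative_mult[OF f'(1) g'(1)]])
qed

text \<open>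
  The chain rule expresses the derivative as a product, which is why closure under products comes
  first; the outer function is real, so its derivative is determined by its value on \<open>1\<close>.
\<close>

lemma k_smooth_compose:
  fixes f :: "real \<Rightarrow> real" and g :: "'a::real_normed_vector \<Rightarrow> real"
  shows "k_smooth n f \<Longrightarrow> k_smooth n g \<Longrightarrow> k_smooth n (\<lambda>x. f (g x))"
proof (induction n arbitrary: f g)
  case 0
  then show ?case
    using continuous_on_compose2[of UNIV f UNIV g] by simp
next
  case (Suc n)
  obtain f' where f': "\<And>x. (f has_derivative f' x) (at x)" "\<And>v. k_smooth n (\<lambda>x. f' x v)"
    using Suc.prems(1) by (rule k_smooth_SucE) blast
  obtain g' where g': "\<And>x. (g has_derivative g' x) (at x)" "\<And>v. k_smooth n (\<lambda>x. g' x v)"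
    using Suc.prems(2) by (rule k_smooth_SucE) blast
  have lin: "f' y w = f' y 1 * w" for y w
    using linear_cmul[OF has_derivative_linear[OF f'(1)[of y]], of w 1] by simp
  have D: "((\<lambda>x. f (g x)) has_derivative (\<lambda>v. f' (g x) 1 * g' x v)) (at x)" for x
    using has_derivative_compose[OF g'(1)[of x] f'(1)[of "g x"]] by (simp add: lin[symmetric])
  have "k_smooth n (\<lambda>x. f' (g x) 1 * g' x v)" for v
    by (rule k_smooth_mult[OF Suc.IH[OF f'(2)[of 1] k_smooth_Suc_imp[OF Suc.prems(2)]] g'(2)])
  then show ?case
    by (rule k_smooth_SucI[OF D])
qed

lemma k_smooth_bounded_linear: "bounded_linear f \<Longrightarrow> k_smooth n f"
proof (cases n)
  case 0
  then show "bounded_linear f \<Longrightarrow> k_smooth n f"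
    by (simp add: linear_continuous_on)
next
  case (Suc m)
  then show "bounded_linear f \<Longrightarrow> k_smooth n f"
    by (simp add: k_smooth_SucI[OF bounded_linear_imp_has_derivative k_smooth_const]
        del: k_smooth.simps)
qed

lemma k_smooth_SucI_real:
  fixes f :: "real \<Rightarrow> real"
  assumes "\<And>x. (f has_real_derivative f' x) (at x)" "k_smooth n f'"
  shows "k_smooth (Suc n) f"
proof (rule k_smooth_SucI)
  show "(f has_derivative (\<lambda>v. f' x * v)) (at x)" for x
    using assms(1) by (simp add: has_field_derivative_def)
  show "k_smooth n (\<lambda>x. f' x * v)" for v
    by (rule k_smooth_mult[OF assms(2) k_smooth_const])
qed

lemma smooth_const: "smooth (\<lambda>x. c)"
  by (simp add: smooth_def k_smooth_const)

lemma smooth_add: "smooth f \<Longrightarrow> smooth g \<Longrightarrow> smooth (\<lambda>x. f x + g x)"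
  by (simp add: smooth_def k_smooth_add)

lemma smooth_mult:
  fixes f g :: "'a::real_normed_vector \<Rightarrow> real"
  shows "smooth f \<Longrightarrow> smooth g \<Longrightarrow> smooth (\<lambda>x. f x * g x)"
  by (simp add: smooth_def k_smooth_mult)

lemma smooth_diff:
  fixes f g :: "'a::real_normed_vector \<Rightarrow> real"
  shows "smooth f \<Longrightarrow> smooth g \<Longrightarrow> smooth (\<lambda>x. f x - g x)"
  using smooth_add[of f "\<lambda>x. - 1 * g x"] smooth_mult[OF smooth_const[of "- 1"], of g] by simp

lemma smooth_compose:
  fixes f :: "real \<Rightarrow> real" and g :: "'a::real_normed_vector \<Rightarrow> real"
  shows "smooth f \<Longrightarrow> smooth g \<Longrightarrow> smooth (\<lambda>x. f (g x))"
  by (simp add: smooth_def k_smooth_compose)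

lemma smooth_bounded_linear: "bounded_linear f \<Longrightarrow> smooth f"
  by (simp add: smooth_def k_smooth_bounded_linear)

lemma smooth_imp_continuous: "smooth f \<Longrightarrow> continuous_on A f"
  unfolding smooth_def by (metis continuous_on_subset k_smooth.simps(1) subset_UNIV)

lemma smooth_imp_differentiable: "smooth f \<Longrightarrow> f differentiable (at x)"
  unfolding smooth_def by (metis k_smooth.simps(2))

lemma smooth_frechet_derivative: "smooth f \<Longrightarrow> smooth (\<lambda>x. frechet_derivative f (at x) v)"
  unfolding smooth_def by (metis k_smooth.simps(2))

lemma smooth_DERIV:
  fixes f :: "real \<Rightarrow> real"
  shows "smooth f \<Longrightarrow> (f has_real_derivative deriv f x) (at x)"
  by (metis DERIV_imp_deriv real_differentiable_def smooth_imp_differentiable)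

lemma smooth_of_DERIV:
  fixes f :: "real \<Rightarrow> real"
  assumes "\<And>x. (f has_real_derivative f' x) (at x)" "smooth f'"
  shows "smooth f"
  using k_smooth_Suc_imp[OF k_smooth_SucI_real[OF assms(1)]] assms(2) by (simp add: smooth_def)

text \<open>
  The linear combinations of \<open>sin\<close> and \<open>cos\<close> are closed under differentiation, which makes the
  induction on the order of differentiability go through.
\<close>

lemma smooth_cos: "smooth (cos :: real \<Rightarrow> real)"
proof -
  have "k_smooth n (\<lambda>x. a * sin x + b * cos x :: real)" for n a b
  proof (induction n arbitrary: a b)
    case 0
    then show ?case by (auto intro!: continuous_intros)
  next
    case (Suc n)
    show ?case
      by (rule k_smooth_SucI_real[OF _ Suc.IH[of "- b" a]])
        (auto intro!: derivative_eq_intros)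
  qed
  from this[of _ 0 1] show ?thesis by (simp add: smooth_def)
qed

section \<open>A smooth step function\<close>

text \<open>
  For $p = 1$ this is the classical function $e^{-1/x}$ that vanishes to infinite order at \<open>0\<close>.
  The polynomial factor makes the family closed under differentiation.
\<close>

definition flat_tail :: "real poly \<Rightarrow> real \<Rightarrow> real" where
  "flat_tail p x = (if 0 < x then poly p (1 / x) * exp (- 1 / x) else 0)"

text \<open>
  With \<open>y = 1 / x\<close> the exponential beats every polynomial.
\<close>

lemma flat_tail_tendsto_0:
  fixes p :: "real poly"
  shows "((\<lambda>x. poly p (1 / x) * exp (- 1 / x)) \<longlongrightarrow> 0) (at_right 0)"
proof -
  have "((\<lambda>y. \<Sum>i\<le>degree p. coeff p i * (y ^ i / exp y)) \<longlongrightarrow> (\<Sum>i\<le>degree p. coeff p i * 0)) at_top"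
    by (intro tendsto_sum tendsto_mult tendsto_const tendsto_power_div_exp_0)
  then have "((\<lambda>y. poly p y * exp (- y)) \<longlongrightarrow> 0) at_top"
    by (simp add: poly_altdef sum_divide_distrib exp_minus divide_inverse sum_distrib_right mult.assoc)
  from filterlim_compose[OF this filterlim_inverse_at_top_right]
  show ?thesis by (simp add: field_simps)
qed

text \<open>
  At \<open>x = 0\<close> the difference quotient from the right is again a member of the family, with one more
  factor \<open>1 / x\<close>, so it tends to \<open>0\<close>.
\<close>

lemma DERIV_flat_tail:
  "(flat_tail p has_real_derivative flat_tail ([:0, 0, 1:] * (p - pderiv p)) x) (at x)"
proof -
  consider "x < 0" | "x = 0" | "0 < x" by linarith
  then show ?thesis
  proof cases
    case 1
    have "((\<lambda>x. 0::real) has_real_derivative 0) (at x)" by simp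
    then have "(flat_tail p has_real_derivative 0) (at x)"
      by (rule has_field_derivative_transform_within_open[of _ _ _ "{..<0}"])
        (use 1 in \<open>auto simp: flat_tail_def\<close>)
    with 1 show ?thesis by (simp add: flat_tail_def)
  next
    case 3
    have "((\<lambda>x. poly p (1 / x) * exp (- 1 / x)) has_real_derivative
        poly ([:0, 0, 1:] * (p - pderiv p)) (1 / x) * exp (- 1 / x)) (at x)"
      using 3 by (auto intro!: derivative_eq_intros poly_DERIV[THEN DERIV_chain2]
          simp: field_simps power2_eq_square)
    then have "(flat_tail p has_real_derivative
        poly ([:0, 0, 1:] * (p - pderiv p)) (1 / x) * exp (- 1 / x)) (at x)"
      by (rule has_field_derivative_transform_within_open[of _ _ _ "{0<..}"])
        (use 3 in \<open>auto simp: flat_tail_def\<close>)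
    with 3 show ?thesis by (simp add: flat_tail_def)
  next
    case 2
    have "((\<lambda>y. flat_tail p y / y) \<longlongrightarrow> 0) (at_left 0)"
      by (rule tendsto_eventually)
        (auto simp: flat_tail_def eventually_at_filter intro!: always_eventually)
    moreover have "((\<lambda>y. flat_tail p y / y) \<longlongrightarrow> 0) (at_right 0)"
      using flat_tail_tendsto_0[of "pCons 0 p"]
      by (rule Lim_transform_eventually)
        (auto simp: flat_tail_def eventually_at_filter intro!: always_eventually)
    ultimately have "((\<lambda>y. flat_tail p y / y) \<longlongrightarrow> 0) (at 0)"
      by (simp add: filterlim_split_at)
    with 2 show ?thesis
      by (simp add: has_field_derivative_iff flat_tail_def)
  qed
qed

lemma smooth_flat_tail: "smooth (flat_tail p)"
proof -
  have "k_smooth n (flat_tail p)" for n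
  proof (induction n arbitrary: p)
    case 0
    then show ?case
      using DERIV_isCont[OF DERIV_flat_tail] by (simp add: continuous_on_eq_continuous_at)
  next
    case (Suc n)
    show ?case by (rule k_smooth_SucI_real[OF DERIV_flat_tail Suc.IH])
  qed
  then show ?thesis by (simp add: smooth_def)
qed

definition bump :: "real \<Rightarrow> real" where
  "bump x = flat_tail 1 x * flat_tail 1 (1 - x)"

lemma smooth_bump: "smooth bump"
proof -
  have "smooth (\<lambda>x::real. 1 - x)"
    by (intro smooth_diff smooth_const smooth_bounded_linear bounded_linear_ident)
  from smooth_mult[OF smooth_flat_tail smooth_compose[OF smooth_flat_tail this]]
  show ?thesis by (simp add: bump_def[abs_def])
qed

lemma bump_nonneg: "0 \<le> bump x"
  by (simp add: bump_def flat_tail_def)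

lemma bump_pos: "0 < x \<Longrightarrow> x < 1 \<Longrightarrow> 0 < bump x"
  by (simp add: bump_def flat_tail_def)

lemma bump_eq_0: "x \<le> 0 \<or> 1 \<le> x \<Longrightarrow> bump x = 0"
  by (auto simp: bump_def flat_tail_def)

lemma indicator_bump: "indicator {0..1} x *\<^sub>R bump x = bump x"
  using bump_eq_0[of x] by (cases "x \<in> {0..1}") auto

definition bump_mass :: real where
  "bump_mass = (LBINT x:{0..1}. bump x)"

lemma continuous_bump: "continuous_on A bump"
  by (rule smooth_imp_continuous[OF smooth_bump])

lemma borel_bump [measurable]: "bump \<in> borel_measurable borel"
  by (rule borel_measurable_continuous_onI[OF continuous_bump])

lemma integrable_bump: "integrable lborel bump"
proof -
  have "integrable lborel (\<lambda>x. indicator {0..1} x *\<^sub>R bump x)"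
    by (intro borel_integrable_compact continuous_bump) auto
  then show ?thesis by (simp only: indicator_bump)
qed

definition smooth_step :: "real \<Rightarrow> real" where
  "smooth_step x = (LBINT y:{..x}. bump y)"

lemma smooth_step_diff:
  assumes "x \<le> y"
  shows "smooth_step y - smooth_step x = (LBINT z=x..y. bump z)"
proof -
  have si: "set_integrable lborel A bump" if "A \<in> sets borel" for A
    using integrable_bump that unfolding set_integrable_def
    by (intro integrable_mult_indicator) auto
  have "(LBINT z:{..x} \<union> {x<..y}. bump z) = (LBINT z:{..x}. bump z) + (LBINT z:{x<..y}. bump z)"
    by (rule set_integral_Un) (auto intro!: si)
  moreover have "{..x} \<union> {x<..y} = {..y}" using assms by auto
  ultimately show ?thesis
    using assms by (simp add: smooth_step_def interval_integral_Ioc)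
qed

lemma smooth_step_neg: "x \<le> 0 \<Longrightarrow> smooth_step x = 0"
  unfolding smooth_step_def set_lebesgue_integral_def
  by (rule integral_eq_zero_AE) (auto simp: bump_eq_0 indicator_def)

lemma smooth_step_eq_mass:
  assumes "1 \<le> x"
  shows "smooth_step x = bump_mass"
  unfolding smooth_step_def bump_mass_def set_lebesgue_integral_def
  by (rule Bochner_Integration.integral_cong) (use assms in \<open>auto simp: bump_eq_0 indicator_def\<close>)

lemma smooth_step_bounds: "0 \<le> smooth_step x" "smooth_step x \<le> bump_mass"
proof -
  have mono: "smooth_step x \<le> smooth_step y" if "x \<le> y" for x y
  proof -
    have "0 \<le> (LBINT z=x..y. bump z)"
      using that by (auto simp: interval_integral_Ioc set_lebesgue_integral_def bump_nonneg
          intro!: integral_nonneg_AE)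
    with smooth_step_diff[OF that] show ?thesis by simp
  qed
  show "0 \<le> smooth_step x"
    using mono[of "min x 0" x] by (simp add: smooth_step_neg)
  show "smooth_step x \<le> bump_mass"
    using mono[of x "max x 1"] by (simp add: smooth_step_eq_mass)
qed

lemma DERIV_smooth_step: "(smooth_step has_real_derivative bump x) (at x)"
proof -
  define F where "F = (\<lambda>u. LBINT z=x-1..u. bump z)"
  have "(F has_vector_derivative bump x) (at x within {x-1..x+1})"
    unfolding F_def by (rule interval_integral_FTC2) (auto intro: continuous_bump)
  then have "(F has_real_derivative bump x) (at x)"
    by (simp add: at_within_Icc_at has_real_derivative_iff_has_vector_derivative)
  from DERIV_add[OF DERIV_const[of "smooth_step (x-1)"] this]
  have D: "((\<lambda>u. smooth_step (x-1) + F u) has_real_derivative bump x) (at x)"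
    by simp
  have "smooth_step (x-1) + F u = smooth_step u" if "u \<in> {x-1<..}" for u
    using smooth_step_diff[of "x-1" u] that by (simp add: F_def)
  from has_field_derivative_transform_within_open[OF D open_greaterThan[of "x-1"] _ this]
  show ?thesis by simp
qed

lemma smooth_smooth_step: "smooth smooth_step"
  by (rule smooth_of_DERIV[OF DERIV_smooth_step smooth_bump])

lemma bump_mass_pos: "0 < bump_mass"
proof -
  have "(LBINT x:{0..1}. bump x) \<noteq> 0"
  proof
    assume *: "(LBINT x:{0..1}. bump x) = 0"
    have int: "integrable lborel (\<lambda>x. indicator {0..1} x *\<^sub>R bump x)"
      by (intro borel_integrable_compact continuous_bump) auto
    have "AE x in lborel. indicator {0..1} x *\<^sub>R bump x = 0"
      by (subst integral_nonneg_eq_0_iff_AE[symmetric, OF int])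
        (use * in \<open>auto simp: bump_nonneg set_lebesgue_integral_def\<close>)
    then have "AE x in lborel. x \<notin> {0<..<1::real}"
    proof eventually_elim
      case (elim x)
      then show ?case
        using bump_pos[of x] by (auto simp: indicator_def split: if_splits)
    qed
    then have "emeasure lborel {0<..<1::real} = 0"
      by (subst (asm) AE_iff_measurable[where N = "{0<..<1}"]) auto
    then show False by simp
  qed
  moreover have "0 \<le> bump_mass"
    using smooth_step_bounds[of 0] by simp
  ultimately show ?thesis by (simp add: bump_mass_def)
qed

text \<open>
  The rescaled steps approximate a multiple of the indicator function of the positive half line.
  This is how indicator functions are reached by smooth test functions.
\<close>

lemma smooth_step_scaled_tendsto:
  "(\<lambda>n. smooth_step (real n * x)) \<longlonglongrightarrow> (if 0 < x then bump_mass else 0)"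
proof (cases "0 < x")
  case True
  have "eventually (\<lambda>n. 1 / x \<le> real n) sequentially"
    using filterlim_real_sequentially unfolding filterlim_at_top by blast
  then have "eventually (\<lambda>n. smooth_step (real n * x) = bump_mass) sequentially"
    by eventually_elim (use True in \<open>auto simp: field_simps intro!: smooth_step_eq_mass\<close>)
  with True show ?thesis by (auto intro: tendsto_eventually)
next
  case False
  then have "smooth_step (real n * x) = 0" for n
    by (intro smooth_step_neg) (simp add: mult_nonneg_nonpos)
  with False show ?thesis by simp
qed

section \<open>Translations, periodicity and null sets\<close>

text \<open>
  Translating a Borel null set that contains the exceptions makes this available for predicates that
  are not known to be measurable, such as the existence of a limit.
\<close>

lemma AE_shift:
  assumes "AE x in lborel. P (x::real)"
  shows "AE x in lborel. P (t + x)"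
proof -
  obtain N where N: "{x. \<not> P x} \<subseteq> N" "emeasure lborel N = 0" "N \<in> sets lborel"
    using AE_E[OF assms] by auto
  from N(2,3) have "AE x in lborel. x \<notin> N"
    by (intro AE_not_in null_setsI) auto
  moreover have "Measurable.pred borel (\<lambda>x. x \<notin> N)"
    using N(3) by measurable
  ultimately have "AE x in lborel. t + 1 * x \<notin> N"
    by (intro AE_borel_affine) auto
  then show ?thesis
    by eventually_elim (use N(1) in auto)
qed

text \<open>
  The representative of a point of the circle in the fundamental domain $[0, 2\pi)$.
\<close>

definition circle_rep :: "real \<Rightarrow> real" where
  "circle_rep x = x - 2 * pi * of_int \<lfloor>x / (2 * pi)\<rfloor>"

lemma circle_rep_bounds: "0 \<le> circle_rep x" "circle_rep x < 2 * pi"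
  using floor_divide_lower[of "2 * pi" x] floor_divide_upper[of "2 * pi" x]
  by (simp_all add: circle_rep_def algebra_simps)

lemma periodic_int_shift:
  assumes "\<And>x. f (x + 2 * pi) = f x"
  shows "f (x + 2 * pi * of_int k) = f x"
proof (induction k rule: int_induct[where k = 0])
  case (step1 i)
  then show ?case using assms[of "x + 2 * pi * of_int i"] by (simp add: algebra_simps)
next
  case (step2 i)
  then show ?case using assms[of "x + 2 * pi * of_int (i - 1)"] by (simp add: algebra_simps)
qed simp

lemma AE_periodicI:
  assumes "AE x in lborel. x \<in> {0..2 * pi} \<longrightarrow> P x" and per: "\<And>x. P (x + 2 * pi) = P x"
  shows "AE x in lborel. P (x::real)"
proof -
  have "AE x in lborel. \<forall>k::int. 2 * pi * of_int k + x \<in> {0..2 * pi} \<longrightarrow> P (2 * pi * of_int k + x)"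
    unfolding AE_all_countable by (intro allI AE_shift assms)
  then show ?thesis
  proof eventually_elim
    case (elim x)
    define k where "k = - \<lfloor>x / (2 * pi)\<rfloor>"
    have "2 * pi * of_int k + x \<in> {0..2 * pi}"
      using circle_rep_bounds[of x] by (simp add: k_def circle_rep_def)
    with elim have "P (2 * pi * of_int k + x)" by blast
    then show ?case using periodic_int_shift[of P x k, OF per] by (simp add: add.commute)
  qed
qed

section \<open>Lebesgue differentiation\<close>

definition locally_bounded :: "(real \<Rightarrow> real) \<Rightarrow> bool" where
  "locally_bounded f \<longleftrightarrow> (\<forall>T. \<exists>C. \<forall>x. \<bar>x\<bar> \<le> T \<longrightarrow> \<bar>f x\<bar> \<le> C)"

lemma locally_boundedD:
  assumes "locally_bounded f"
  obtains C where "\<And>x. \<bar>x\<bar> \<le> T \<Longrightarrow> \<bar>f x\<bar> \<le> C" "0 \<le> C"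
proof -
  obtain C where "\<And>x. \<bar>x\<bar> \<le> T \<Longrightarrow> \<bar>f x\<bar> \<le> C"
    using assms unfolding locally_bounded_def by meson
  then show ?thesis by (intro that[of "max C 0"]) fastforce+
qed

lemma locally_bounded_mult:
  assumes "locally_bounded f" "locally_bounded g"
  shows "locally_bounded (\<lambda>x. f x * g x)"
  unfolding locally_bounded_def
proof
  fix T
  obtain C where C: "\<And>x. \<bar>x\<bar> \<le> T \<Longrightarrow> \<bar>f x\<bar> \<le> C" "0 \<le> C"
    using locally_boundedD[OF assms(1)] by metis
  obtain D where D: "\<And>x. \<bar>x\<bar> \<le> T \<Longrightarrow> \<bar>g x\<bar> \<le> D"
    using locally_boundedD[OF assms(2)] by metis
  show "\<exists>C. \<forall>x. \<bar>x\<bar> \<le> T \<longrightarrow> \<bar>f x * g x\<bar> \<le> C"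
    using C D by (intro exI[of _ "C * D"]) (auto simp: abs_mult intro!: mult_mono)
qed

lemma locally_bounded_continuous:
  assumes "continuous_on UNIV f"
  shows "locally_bounded f"
  unfolding locally_bounded_def
proof
  fix T
  have "bounded (f ` {- T..T})"
    by (intro compact_imp_bounded compact_continuous_image continuous_on_subset[OF assms]) auto
  then show "\<exists>C. \<forall>x. \<bar>x\<bar> \<le> T \<longrightarrow> \<bar>f x\<bar> \<le> C"
    by (force simp: bounded_iff abs_le_iff)
qed

lemma set_integrable_locally_bounded:
  assumes [measurable]: "f \<in> borel_measurable borel" and "locally_bounded f"
  shows "set_integrable lborel {a..b} f"
proof -
  obtain C where C: "\<And>x. \<bar>x\<bar> \<le> max \<bar>a\<bar> \<bar>b\<bar> \<Longrightarrow> \<bar>f x\<bar> \<le> C"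
    using locally_boundedD[OF assms(2)] by metis
  show ?thesis
    unfolding set_integrable_def
    by (rule integrableI_bounded_set_indicator[where B = C])
      (auto intro!: AE_I2 C simp: emeasure_lborel_Icc_eq)
qed

text \<open>
  The one-sided cubes in \<open>integrable_ccontinuous_explicit\<close> are intervals to the right of their
  base point.
\<close>

lemma lebesgue_differentiation_right:
  assumes f: "f \<in> borel_measurable borel" "locally_bounded f"
  shows "AE x in lborel. ((\<lambda>\<epsilon>. (LBINT y:{x..x + \<epsilon>}. f y) / \<epsilon>) \<longlongrightarrow> f x) (at_right 0)"
proof -
  note int = set_integrable_locally_bounded[OF f]
  have "f integrable_on cbox a b" for a b
    using set_borel_integral_eq_integral(1)[OF int[of a b]] by simp
  then obtain N where N: "negligible N"
    "\<And>x e. \<lbrakk>x \<notin> N; 0 < e\<rbrakk> \<Longrightarrow> \<exists>d>0. \<forall>h. 0 < h \<and> h < d \<longrightarrow>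
       norm (integral (cbox x (x + h *\<^sub>R One)) f /\<^sub>R h ^ DIM(real) - f x) < e"
    using integrable_ccontinuous_explicit[of f] by metis
  have "AE x in lebesgue. x \<notin> N"
    using N(1) by (intro AE_not_in) (simp add: negligible_iff_null_sets)
  then have "AE x in lborel. x \<notin> N"
    by (simp add: AE_completion_iff)
  then show ?thesis
  proof eventually_elim
    case (elim x)
    show ?case
    proof (rule tendstoI)
      fix e :: real assume "0 < e"
      from N(2)[OF elim this] obtain d where d: "d > 0"
        "\<And>h. 0 < h \<Longrightarrow> h < d \<Longrightarrow> norm (integral {x..x + h} f / h - f x) < e"
        by (auto simp: divide_inverse mult.commute)
      have "eventually (\<lambda>h. 0 < h \<and> h < d) (at_right 0)"
        using \<open>d > 0\<close> by (auto simp: eventually_at_right_field)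
      then show "eventually (\<lambda>\<epsilon>. dist ((LBINT y:{x..x + \<epsilon>}. f y) / \<epsilon>) (f x) < e) (at_right 0)"
      proof eventually_elim
        case (elim h)
        with d(2)[of h] show ?case
          by (simp add: dist_norm set_borel_integral_eq_integral(2)[OF int])
      qed
    qed
  qed
qed

text \<open>
  Reflection of the statement for right-sided means.
\<close>

lemma lebesgue_differentiation_left:
  assumes f[measurable]: "f \<in> borel_measurable borel" and lb: "locally_bounded f"
  shows "AE x in lborel. ((\<lambda>\<epsilon>. (LBINT y:{x - \<epsilon>..x}. f y) / \<epsilon>) \<longlongrightarrow> f x) (at_right 0)"
proof -
  have "locally_bounded (\<lambda>x. f (- x))"
    using lb unfolding locally_bounded_def by (metis abs_minus_cancel)
  then have "AE x in lborel.
      ((\<lambda>\<epsilon>. (LBINT y:{x..x + \<epsilon>}. f (- y)) / \<epsilon>) \<longlongrightarrow> f (- x)) (at_right 0)"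
    by (intro lebesgue_differentiation_right) measurable
  moreover have "(LBINT y:{x..x + \<epsilon>}. f (- y)) = (LBINT y:{- x - \<epsilon>..- x}. f y)" for x \<epsilon>
    unfolding set_lebesgue_integral_def
    by (subst lborel_integral_real_affine[of "-1" _ 0])
      (auto simp: indicator_def intro!: Bochner_Integration.integral_cong)
  ultimately have "AE x in lborel.
      ((\<lambda>\<epsilon>. (LBINT y:{- x - \<epsilon>..- x}. f y) / \<epsilon>) \<longlongrightarrow> f (- x)) (at_right 0)"
    by simp
  then obtain N where N: "{x. \<not> ((\<lambda>\<epsilon>. (LBINT y:{- x - \<epsilon>..- x}. f y) / \<epsilon>) \<longlongrightarrow> f (- x)) (at_right 0)} \<subseteq> N"
     "emeasure lborel N = 0" "N \<in> sets lborel"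
    by (auto elim!: AE_E)
  have "AE x in lborel. x \<notin> N"
    using N(2,3) by (intro AE_not_in null_setsI) auto
  then have "AE x in lborel. 0 + (-1) * x \<notin> N"
    using N(3) by (intro AE_borel_affine) auto
  then show ?thesis
  proof eventually_elim
    case (elim x)
    then have "- x \<notin> N" by simp
    with N(1) have "((\<lambda>\<epsilon>. (LBINT y:{- (- x) - \<epsilon>..- (- x)}. f y) / \<epsilon>) \<longlongrightarrow> f (- (- x))) (at_right 0)"
      by blast
    then show ?case by simp
  qed
qed

lemma AE_eq_0_if_interval_integrals_0:
  assumes f: "f \<in> borel_measurable borel" "locally_bounded f"
    and 0: "\<And>a b. A \<le> a \<Longrightarrow> a < b \<Longrightarrow> b \<le> B \<Longrightarrow> (LBINT x:{a..b}. f x) = 0"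
  shows "AE x in lborel. x \<in> {A..B} \<longrightarrow> f x = 0"
proof -
  have "AE x in lborel. x \<noteq> B"
    by (rule AE_lborel_singleton)
  with lebesgue_differentiation_right[OF f] show ?thesis
  proof eventually_elim
    case (elim x)
    show ?case
    proof
      assume x: "x \<in> {A..B}"
      with elim have "x < B" by auto
      then have "eventually (\<lambda>\<epsilon>. 0 < \<epsilon> \<and> x + \<epsilon> \<le> B) (at_right 0)"
        unfolding eventually_at_right_field by (intro exI[of _ "B - x"]) auto
      then have "eventually (\<lambda>\<epsilon>. (LBINT y:{x..x + \<epsilon>}. f y) / \<epsilon> = 0) (at_right 0)"
        by eventually_elim (use x in \<open>auto intro!: 0\<close>)
      then have "((\<lambda>\<epsilon>. (LBINT y:{x..x + \<epsilon>}. f y) / \<epsilon>) \<longlongrightarrow> 0) (at_right 0)"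
        by (rule tendsto_eventually)
      with elim(1) show "f x = 0"
        using tendsto_unique[OF trivial_limit_at_right_real] by blast
    qed
  qed
qed

section \<open>Testing against smooth functions\<close>

text \<open>
  An arc of the circle is a superlevel set of a translated cosine. This allows indicator functions
  of arcs to be approximated by smooth functions that are periodic from the start.
\<close>

lemma arc_iff_cos:
  fixes a b x :: real
  assumes "0 \<le> a" "a < b" "b \<le> 2 * pi" "x \<in> {0..2 * pi}"
  shows "cos ((b - a) / 2) < cos (x - (a + b) / 2) \<longleftrightarrow> a < x \<and> x < b"
proof -
  define r y where "r = (b - a) / 2" and "y = \<bar>x - (a + b) / 2\<bar>"
  have r: "0 < r" "r \<le> pi" and y: "0 \<le> y" "y \<le> 2 * pi - r"
    using assms by (auto simp: r_def y_def abs_if field_simps)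
  have "cos r < cos y \<longleftrightarrow> y < r"
  proof (cases "y \<le> pi")
    case True
    then show ?thesis using cos_mono_less_eq[of r y] r y by auto
  next
    case False
    then have "cos (2 * pi - y) \<le> cos r"
      using r y cos_mono_le_eq[of "2 * pi - y" r] by auto
    with False r show ?thesis by (simp add: cos_diff)
  qed
  moreover have "cos y = cos (x - (a + b) / 2)"
    by (simp add: y_def abs_if cos_minus[of "x - (a + b) / 2", symmetric])
  moreover have "y < r \<longleftrightarrow> a < x \<and> x < b"
    by (auto simp: r_def y_def abs_if field_simps)
  ultimately show ?thesis by (simp add: r_def)
qed

lemma circle_test_function_arc:
  "circle_test_function (\<lambda>x. smooth_step (real n * (cos (x - c) - d)))"
proof -
  have "smooth (\<lambda>x::real. x - c)"
    by (intro smooth_diff smooth_const smooth_bounded_linear bounded_linear_ident)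
  from smooth_compose[OF smooth_cos this]
  have "smooth (\<lambda>x. real n * (cos (x - c) - d))"
    by (intro smooth_mult[OF smooth_const] smooth_diff smooth_const)
  from smooth_compose[OF smooth_smooth_step this] show ?thesis
    unfolding circle_test_function_def circle_function_def
    by (simp add: diff_add_eq[symmetric])
qed

text \<open>
  The test functions \<open>circle_test_function_arc\<close> converge boundedly to multiples of the indicator
  functions of arcs, so orthogonality to test functions makes all integrals over intervals vanish.
\<close>

lemma AE_eq_0_if_orthogonal_to_test_functions:
  assumes f[measurable]: "f \<in> borel_measurable borel" and lb: "locally_bounded f"
    and 0: "\<And>\<psi>. circle_test_function \<psi> \<Longrightarrow> (LBINT x:{0..2 * pi}. f x * \<psi> x) = 0"
  shows "AE x in lborel. x \<in> {0..2 * pi} \<longrightarrow> f x = 0"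
proof (rule AE_eq_0_if_interval_integrals_0[OF f lb])
  fix a b :: real assume ab: "0 \<le> a" "a < b" "b \<le> 2 * pi"
  define \<psi> where "\<psi> = (\<lambda>n x. smooth_step (real n * (cos (x - (a + b) / 2) - cos ((b - a) / 2))))"
  note [measurable] = borel_measurable_continuous_onI[OF smooth_imp_continuous[OF smooth_smooth_step]]
  have "(\<lambda>n. LBINT x. indicator {0..2 * pi} x *\<^sub>R (f x * \<psi> n x)) \<longlonglongrightarrow>
      (LBINT x. bump_mass * (indicator {a..b} x *\<^sub>R f x))"
  proof (rule integral_dominated_convergence)
    show "integrable lborel (\<lambda>x. bump_mass * \<bar>indicator {0..2 * pi} x *\<^sub>R f x\<bar>)"
      using set_integrable_locally_bounded[OF f lb, of 0 "2 * pi"]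
      unfolding set_integrable_def by (intro integrable_mult_right integrable_abs)
    show "AE x in lborel. norm (indicator {0..2 * pi} x *\<^sub>R (f x * \<psi> n x))
        \<le> bump_mass * \<bar>indicator {0..2 * pi} x *\<^sub>R f x\<bar>" for n
      using smooth_step_bounds
      by (intro AE_I2) (auto simp: \<psi>_def abs_mult indicator_def mult.commute[of bump_mass]
          intro!: mult_left_mono)
    have "AE x in lborel. x \<noteq> a \<and> x \<noteq> b"
      using AE_lborel_singleton[of a] AE_lborel_singleton[of b] by eventually_elim auto
    then show "AE x in lborel. (\<lambda>n. indicator {0..2 * pi} x *\<^sub>R (f x * \<psi> n x))
        \<longlonglongrightarrow> bump_mass * (indicator {a..b} x *\<^sub>R f x)"
    proof eventually_elim
      case (elim x)
      show ?case
      proof (cases "x \<in> {0..2 * pi}")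
        case True
        have "(\<lambda>n. f x * \<psi> n x) \<longlonglongrightarrow> f x * (if a < x \<and> x < b then bump_mass else 0)"
          using smooth_step_scaled_tendsto[of "cos (x - (a + b) / 2) - cos ((b - a) / 2)"]
            arc_iff_cos[OF ab True]
          unfolding \<psi>_def by (intro tendsto_mult tendsto_const) simp
        then show ?thesis
          using True elim by (auto simp: indicator_def mult.commute split: if_splits)
      next
        case False
        then show ?thesis using ab by (auto simp: indicator_def)
      qed
    qed
  qed (auto simp: \<psi>_def)
  moreover have "(LBINT x. indicator {0..2 * pi} x *\<^sub>R (f x * \<psi> n x)) = 0" for n
    using 0[OF circle_test_function_arc] by (simp add: \<psi>_def set_lebesgue_integral_def)
  ultimately have "(LBINT x. bump_mass * (indicator {a..b} x *\<^sub>R f x)) = 0"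
    by (simp add: LIMSEQ_const_iff)
  then show "(LBINT x:{a..b}. f x) = 0"
    using bump_mass_pos by (simp add: set_lebesgue_integral_def)
qed

lemma integrable_continuous_bounded_support:
  fixes f :: "real \<Rightarrow> real"
  assumes "continuous_on UNIV f" "\<And>x. x \<notin> {a..b} \<Longrightarrow> f x = 0"
  shows "integrable lborel f"
proof -
  have "integrable lborel (\<lambda>x. indicator {a..b} x *\<^sub>R f x)"
    by (intro borel_integrable_compact continuous_on_subset[OF assms(1)]) auto
  moreover have "(\<lambda>x. indicator {a..b} x *\<^sub>R f x) = f"
    using assms(2) by (auto simp: fun_eq_iff indicator_def)
  ultimately show ?thesis by simp
qed

text \<open>
  The rescaled bumps are an approximate identity. Their support $[c, c + 1/(n+1)]$ lies to the
  right of \<open>c\<close>, so that for positive \<open>c\<close> they live on the open half line.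
\<close>

lemma bump_concentrates:
  assumes B: "continuous_on UNIV B"
  shows "(\<lambda>n. LBINT s. real (Suc n) * bump (real (Suc n) * (s - c)) * B s) \<longlonglongrightarrow> bump_mass * B c"
proof -
  have [measurable]: "B \<in> borel_measurable borel"
    by (rule borel_measurable_continuous_onI[OF B])
  obtain M where M: "\<And>s. s \<in> {c..c + 1} \<Longrightarrow> \<bar>B s\<bar> \<le> M"
  proof -
    have "bounded (B ` {c..c + 1})"
      by (intro compact_imp_bounded compact_continuous_image continuous_on_subset[OF B]) auto
    then show ?thesis using that by (force simp: bounded_iff)
  qed
  have "(\<lambda>n. LBINT r. bump r * B (c + r / real (Suc n))) \<longlonglongrightarrow> (LBINT r. bump r * B c)"
  proof (rule integral_dominated_convergence)
    show "integrable lborel (\<lambda>r. bump r * M)"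
      by (intro integrable_mult_left integrable_bump)
    show "AE r in lborel. norm (bump r * B (c + r / real (Suc n))) \<le> bump r * M" for n
    proof (rule AE_I2)
      fix r
      show "norm (bump r * B (c + r / real (Suc n))) \<le> bump r * M"
      proof (cases "r \<in> {0..1}")
        case True
        then have "c + r / real (Suc n) \<in> {c..c + 1}" by (auto simp: field_simps)
        from M[OF this] show ?thesis by (auto simp: abs_mult bump_nonneg intro!: mult_left_mono)
      qed (auto simp: bump_eq_0)
    qed
    show "AE r in lborel. (\<lambda>n. bump r * B (c + r / real (Suc n))) \<longlonglongrightarrow> bump r * B c"
    proof (rule AE_I2)
      fix r
      have "(\<lambda>n. c + r / real (Suc n)) \<longlonglongrightarrow> c + 0"
        by (intro tendsto_add tendsto_const LIMSEQ_Suc[OF lim_const_over_n])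
      moreover have "isCont B c"
        using B by (simp add: continuous_on_eq_continuous_at)
      ultimately have "(\<lambda>n. B (c + r / real (Suc n))) \<longlonglongrightarrow> B c"
        by (metis add.right_neutral isCont_tendsto_compose)
      then show "(\<lambda>n. bump r * B (c + r / real (Suc n))) \<longlonglongrightarrow> bump r * B c"
        by (rule tendsto_mult_left)
    qed
  qed auto
  moreover have "(LBINT s. real (Suc n) * bump (real (Suc n) * (s - c)) * B s)
      = (LBINT r. bump r * B (c + r / real (Suc n)))" for n
    by (subst lborel_integral_real_affine[of "1 / real (Suc n)" _ c]) (auto simp: mult.assoc)
  moreover have "bump_mass = (LBINT r. bump r)"
    unfolding bump_mass_def set_lebesgue_integral_def
    by (simp only: indicator_bump)
  ultimately show ?thesis by simp
qed

text \<open>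
  Testing with the difference of two rescaled steps at \<open>a\<close> and \<open>b\<close>, whose derivative is a
  difference of bumps, gives $B(a) = B(b)$ in the limit for positive \<open>a\<close> and \<open>b\<close>. Continuity
  extends this to \<open>0\<close>, which no test function can see.
\<close>

lemma continuous_eq_initial_value_if_weak_derivative_0:
  fixes B :: "real \<Rightarrow> real"
  assumes B: "continuous_on UNIV B"
    and 0: "\<And>\<eta> a b. smooth \<eta> \<Longrightarrow> 0 < a \<Longrightarrow> (\<And>t. t \<notin> {a..b} \<Longrightarrow> \<eta> t = 0) \<Longrightarrow>
      (LBINT t. deriv \<eta> t * B t) = 0"
    and "0 \<le> t"
  shows "B t = B 0"
proof -
  define \<rho> where "\<rho> = (\<lambda>c n s. real (Suc n) * bump (real (Suc n) * (s - c)))"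
  have const: "B a = B b" if "0 < a" "a \<le> b" for a b :: real
  proof -
    have "(LBINT s. \<rho> a n s * B s) = (LBINT s. \<rho> b n s * B s)" for n
    proof -
      define \<eta> where
        "\<eta> = (\<lambda>s. smooth_step (real (Suc n) * (s - a)) - smooth_step (real (Suc n) * (s - b)))"
      have sm: "smooth (\<lambda>s::real. real (Suc n) * (s - c))" for c
        by (intro smooth_mult[OF smooth_const] smooth_diff smooth_const smooth_bounded_linear
            bounded_linear_ident)
      have "smooth \<eta>"
        unfolding \<eta>_def by (rule smooth_diff[OF smooth_compose[OF smooth_smooth_step sm]
              smooth_compose[OF smooth_smooth_step sm]])
      moreover have "\<eta> s = 0" if "s \<notin> {a..b + 1}" for s
      proof (cases "s < a")
        case True
        with \<open>a \<le> b\<close> show ?thesis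
          by (simp add: \<eta>_def smooth_step_neg mult_nonneg_nonpos)
      next
        case False
        with that have s: "b + 1 < s" by auto
        have "1 \<le> real (Suc n) * (s - c)" if "c \<le> b" for c
          using s that mult_mono[of 1 "real (Suc n)" 1 "s - c"] by auto
        with \<open>a \<le> b\<close> show ?thesis
          unfolding \<eta>_def by (simp only: smooth_step_eq_mass)
      qed
      moreover have "deriv \<eta> s = \<rho> a n s - \<rho> b n s" for s
        unfolding \<eta>_def \<rho>_def
        by (rule DERIV_imp_deriv)
          (auto intro!: derivative_eq_intros DERIV_smooth_step[THEN DERIV_chain2])
      ultimately have "(LBINT s. (\<rho> a n s - \<rho> b n s) * B s) = 0"
        using 0[of \<eta> a "b + 1"] \<open>0 < a\<close> by simp
      moreover have "integrable lborel (\<lambda>s. \<rho> c n s * B s)" for c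
      proof (rule integrable_continuous_bounded_support)
        show "continuous_on UNIV (\<lambda>s. \<rho> c n s * B s)"
          unfolding \<rho>_def
          by (intro continuous_intros B continuous_on_compose2[OF continuous_bump[of UNIV]]) auto
        show "\<rho> c n s * B s = 0" if "s \<notin> {c..c + 1}" for s
        proof -
          have "real (Suc n) * (s - c) \<le> 0 \<or> 1 \<le> real (Suc n) * (s - c)"
            using that mult_mono[of 1 "real (Suc n)" 1 "s - c"]
            by (auto simp: mult_nonneg_nonpos not_le)
          then show ?thesis unfolding \<rho>_def by (simp only: bump_eq_0 mult_zero_left mult_zero_right)
        qed
      qed
      ultimately show ?thesis
        by (simp add: left_diff_distrib)
    qed
    with bump_concentrates[OF B, of a] bump_concentrates[OF B, of b]
    have "bump_mass * B a = bump_mass * B b"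
      unfolding \<rho>_def by (simp only: LIMSEQ_unique)
    then show ?thesis using bump_mass_pos by simp
  qed
  show ?thesis
  proof (cases "t = 0")
    case False
    with \<open>0 \<le> t\<close> have "0 < t" by simp
    have "(\<lambda>n. t / real (Suc n)) \<longlonglongrightarrow> 0"
      by (rule LIMSEQ_Suc[OF lim_const_over_n])
    then have "(\<lambda>n. B (t / real (Suc n))) \<longlonglongrightarrow> B 0"
      using B by (auto simp: continuous_on_eq_continuous_at intro: isCont_tendsto_compose)
    moreover have "B (t / real (Suc n)) = B t" for n
      using \<open>0 < t\<close> by (intro const) (auto simp: field_simps)
    ultimately show ?thesis by (simp add: LIMSEQ_const_iff)
  qed simp
qed

section \<open>The wave equation in terms of characteristic derivatives\<close>

text \<open>
  The regularity part of a bounded solution, with boundedness required only for bounded times: the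
  profile wave attached to a given \<open>u\<close> is at first only known to grow at most linearly.
\<close>

definition locally_bounded_wave :: "(real \<Rightarrow> real \<Rightarrow> real) \<Rightarrow> bool" where
  "locally_bounded_wave g \<longleftrightarrow>
     (\<forall>t\<ge>0. circle_function (\<lambda>x. g x t)) \<and>
     set_borel_measurable borel (UNIV \<times> {0..}) (\<lambda>(x, t). g x t) \<and>
     (\<forall>T. \<exists>C. \<forall>x. \<forall>t\<in>{0..T}. \<bar>g x t\<bar> \<le> C)"

lemma locally_bounded_waveD:
  assumes "locally_bounded_wave g"
  obtains C where "\<And>x t. 0 \<le> t \<Longrightarrow> t \<le> T \<Longrightarrow> \<bar>g x t\<bar> \<le> C" "0 \<le> C"
proof -
  obtain C where "\<And>x t. t \<in> {0..T} \<Longrightarrow> \<bar>g x t\<bar> \<le> C"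
    using assms unfolding locally_bounded_wave_def by meson
  then show ?thesis by (intro that[of "max C 0"]) (auto intro: max.coboundedI1)
qed

text \<open>
  Extension by \<open>0\<close> to negative times turns measurability on the half space into plain Borel
  measurability.
\<close>

lemma locally_bounded_wave_measurable:
  assumes "locally_bounded_wave g"
  shows "(\<lambda>p. if 0 \<le> snd p then g (fst p) (snd p) else 0) \<in> borel_measurable borel"
proof -
  have "(\<lambda>p. indicator (UNIV \<times> {0..}) p *\<^sub>R (case p of (x, t) \<Rightarrow> g x t)) \<in> borel_measurable borel"
    using assms by (simp add: locally_bounded_wave_def set_borel_measurable_def)
  moreover have "(\<lambda>p. indicator (UNIV \<times> {0..}) p *\<^sub>R (case p of (x, t) \<Rightarrow> g x t))
      = (\<lambda>p. if 0 \<le> snd p then g (fst p) (snd p) else 0)"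
    by (auto simp: fun_eq_iff indicator_def)
  ultimately show ?thesis by simp
qed

lemma locally_bounded_wave_slice_measurable:
  assumes "locally_bounded_wave g" "0 \<le> t"
  shows "(\<lambda>x. g x t) \<in> borel_measurable borel"
proof -
  have "(\<lambda>x. (x, t)) \<in> borel \<rightarrow>\<^sub>M (borel :: (real \<times> real) measure)"
    by (intro borel_measurable_continuous_onI continuous_intros)
  from measurable_compose[OF this locally_bounded_wave_measurable[OF assms(1)]] assms(2)
  show ?thesis by simp
qed

lemma locally_bounded_wave_slice_bounded:
  assumes "locally_bounded_wave g" "0 \<le> t"
  shows "locally_bounded (\<lambda>x. g x t)"
proof -
  obtain C where "\<And>x s. 0 \<le> s \<Longrightarrow> s \<le> t \<Longrightarrow> \<bar>g x s\<bar> \<le> C"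
    using locally_bounded_waveD[OF assms(1)] by metis
  with assms(2) show ?thesis unfolding locally_bounded_def by blast
qed

lemma locally_bounded_wave_diff:
  assumes g: "locally_bounded_wave g" and h: "locally_bounded_wave h"
  shows "locally_bounded_wave (\<lambda>x t. g x t - h x t)"
  unfolding locally_bounded_wave_def
proof (intro conjI allI impI)
  show "circle_function (\<lambda>x. g x t - h x t)" if "0 \<le> t" for t
    using g h that by (simp add: locally_bounded_wave_def circle_function_def)
  have "(\<lambda>p. (if 0 \<le> snd p then g (fst p) (snd p) else 0)
      - (if 0 \<le> snd p then h (fst p) (snd p) else 0)) \<in> borel_measurable borel"
    by (intro borel_measurable_diff locally_bounded_wave_measurable g h)
  moreover have "(\<lambda>p. (if 0 \<le> snd p then g (fst p) (snd p) else 0)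
      - (if 0 \<le> snd p then h (fst p) (snd p) else 0))
      = (\<lambda>p. indicator (UNIV \<times> {0..}) p *\<^sub>R (case p of (x, t) \<Rightarrow> g x t - h x t))"
    by (auto simp: fun_eq_iff indicator_def)
  ultimately show "set_borel_measurable borel (UNIV \<times> {0..}) (\<lambda>(x, t). g x t - h x t)"
    by (simp add: set_borel_measurable_def)
  fix T
  obtain C where C: "\<And>x t. 0 \<le> t \<Longrightarrow> t \<le> T \<Longrightarrow> \<bar>g x t\<bar> \<le> C"
    using locally_bounded_waveD[OF g] by metis
  obtain D where D: "\<And>x t. 0 \<le> t \<Longrightarrow> t \<le> T \<Longrightarrow> \<bar>h x t\<bar> \<le> D"
    using locally_bounded_waveD[OF h] by metis
  show "\<exists>C. \<forall>x. \<forall>t\<in>{0..T}. \<bar>g x t - h x t\<bar> \<le> C"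
  proof (intro exI[of _ "C + D"] allI ballI)
    fix x t assume "t \<in> {0..T}"
    with C[of t x] D[of t x] show "\<bar>g x t - h x t\<bar> \<le> C + D" by auto
  qed
qed

lemma set_integrable_wave:
  assumes g: "locally_bounded_wave g" and D: "continuous_on UNIV D"
    and supp: "\<And>x t. t \<notin> {a..b} \<Longrightarrow> D (x, t) = 0"
  shows "set_integrable lborel ({0..2 * pi} \<times> {0..}) (\<lambda>(x, t). g x t * D (x, t))"
proof -
  define f where "f = (\<lambda>p. indicator ({0..2 * pi} \<times> {0..}) p *
      ((if 0 \<le> snd p then g (fst p) (snd p) else 0) * D p))"
  have [measurable]: "D \<in> borel_measurable borel"
    by (rule borel_measurable_continuous_onI[OF D])
  note [measurable] = locally_bounded_wave_measurable[OF g]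
  have S[measurable]: "{0..2 * pi} \<times> {0::real..} \<in> sets borel"
    by (intro borel_closed closed_Times) auto
  obtain C where C: "\<And>x t. 0 \<le> t \<Longrightarrow> t \<le> b \<Longrightarrow> \<bar>g x t\<bar> \<le> C" "0 \<le> C"
    using locally_bounded_waveD[OF g] by metis
  have "compact (D ` ({0..2 * pi} \<times> {0..b}))"
    by (intro compact_continuous_image continuous_on_subset[OF D] compact_Times) auto
  then obtain M where M: "\<And>x t. x \<in> {0..2 * pi} \<Longrightarrow> t \<in> {0..b} \<Longrightarrow> \<bar>D (x, t)\<bar> \<le> M"
    by (force simp: bounded_iff dest!: compact_imp_bounded)
  have "integrable lborel f"
  proof (rule integrableI_bounded_set[where A = "cbox (0, 0) (2 * pi, b)" and B = "C * M"])
    show "f \<in> borel_measurable lborel"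
      unfolding f_def by simp
    show "emeasure lborel (cbox (0, 0) (2 * pi, b)) < \<infinity>"
      by (rule emeasure_lborel_cbox_finite)
    show "AE p in lborel. p \<in> cbox (0, 0) (2 * pi, b) \<longrightarrow> norm (f p) \<le> C * M"
      using C M by (intro AE_I2) (auto simp: f_def abs_mult indicator_def cbox_Pair_eq intro!: mult_mono)
    show "AE p in lborel. p \<notin> cbox (0, 0) (2 * pi, b) \<longrightarrow> f p = 0"
    proof (intro AE_I2 impI)
      fix p :: "real \<times> real" assume p: "p \<notin> cbox (0, 0) (2 * pi, b)"
      show "f p = 0"
        using p supp[of "snd p" "fst p"] by (cases p) (auto simp: f_def indicator_def cbox_Pair_eq)
    qed
  qed simp
  moreover have "f = (\<lambda>p. indicator ({0..2 * pi} \<times> {0..}) p *\<^sub>R (case p of (x, t) \<Rightarrow> g x t * D (x, t)))"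
    by (auto simp: fun_eq_iff f_def indicator_def)
  ultimately show ?thesis by (simp add: set_integrable_def)
qed

lemma wave_integral_Fubini:
  assumes "locally_bounded_wave g" "continuous_on UNIV D"
    and "\<And>x t. t \<notin> {a..b} \<Longrightarrow> D (x, t) = 0"
  shows "(LINT (x, t):{0..2 * pi} \<times> {0..}|lborel. g x t * D (x, t))
    = (LINT t:{0..}|lborel. LINT x:{0..2 * pi}|lborel. g x t * D (x, t))"
proof -
  define f where "f = (\<lambda>x t. indicator {0..2 * pi} x * indicator {0..} t * (g x t * D (x, t)))"
  have f: "(\<lambda>p. indicator ({0..2 * pi} \<times> {0..}) p *\<^sub>R (case p of (x, t) \<Rightarrow> g x t * D (x, t)))
      = case_prod f"
    by (auto simp: fun_eq_iff f_def indicator_def)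
  have "integrable (lborel \<Otimes>\<^sub>M lborel) (case_prod f)"
    using set_integrable_wave[OF assms] unfolding set_integrable_def f lborel_prod .
  then have "(LINT t|lborel. LINT x|lborel. f x t) = integral\<^sup>L (lborel \<Otimes>\<^sub>M lborel) (case_prod f)"
    by (rule lborel_pair.integral_snd)
  moreover have "(LINT x|lborel. f x t)
      = indicator {0..} t *\<^sub>R (LINT x:{0..2 * pi}|lborel. g x t * D (x, t))" for t
    by (simp add: f_def set_lebesgue_integral_def indicator_def)
  ultimately show ?thesis
    unfolding set_lebesgue_integral_def[of lborel "{0..2 * pi} \<times> {0..}"] f lborel_prod
      set_lebesgue_integral_def[of lborel "{0..}"] by simp
qed

text \<open>
  The operator $\partial_x - \partial_t$ that the weak formulation applies to the test function,
  as one directional derivative.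
\<close>

definition transport_derivative :: "(real \<times> real \<Rightarrow> real) \<Rightarrow> real \<times> real \<Rightarrow> real" where
  "transport_derivative \<psi> p = frechet_derivative \<psi> (at p) (1, -1)"

lemma transport_derivative_eq:
  assumes "(\<psi> has_derivative D) (at p)"
  shows "transport_derivative \<psi> p = D (1, -1)"
  unfolding transport_derivative_def using frechet_derivative_at[OF assms] by simp

lemma transport_derivative_partials:
  assumes "smooth \<psi>"
  shows "- deriv (\<lambda>s. \<psi> (x, s)) t + deriv (\<lambda>y. \<psi> (y, t)) x = transport_derivative \<psi> (x, t)"
proof -
  define D where "D = frechet_derivative \<psi> (at (x, t))"
  have D: "(\<psi> has_derivative D) (at (x, t))"
    using smooth_imp_differentiable[OF assms] by (simp add: D_def frechet_derivative_works[symmetric])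
  have lin: "linear D" by (rule has_derivative_linear[OF D])
  have e0: "(\<lambda>h. D (0, h)) = (*) (D (0, 1))"
  proof
    show "D (0, h) = D (0, 1) * h" for h
      using linear_cmul[OF lin, of h "(0, 1)"] by (simp add: mult.commute)
  qed
  have e1: "(\<lambda>h. D (h, 0)) = (*) (D (1, 0))"
  proof
    show "D (h, 0) = D (1, 0) * h" for h
      using linear_cmul[OF lin, of h "(1, 0)"] by (simp add: mult.commute)
  qed
  have "((\<lambda>s. (x, s)) has_derivative (\<lambda>h. (0, h))) (at t)"
    by (rule has_derivative_Pair[OF has_derivative_const has_derivative_ident])
  from has_derivative_compose[OF this D]
  have "((\<lambda>s. \<psi> (x, s)) has_real_derivative D (0, 1)) (at t)"
    unfolding e0 has_field_derivative_def .
  from DERIV_imp_deriv[OF this] have 1: "deriv (\<lambda>s. \<psi> (x, s)) t = D (0, 1)" .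
  have "((\<lambda>y. (y, t)) has_derivative (\<lambda>h. (h, 0))) (at x)"
    by (rule has_derivative_Pair[OF has_derivative_ident has_derivative_const])
  from has_derivative_compose[OF this D]
  have "((\<lambda>y. \<psi> (y, t)) has_real_derivative D (1, 0)) (at x)"
    unfolding e1 has_field_derivative_def .
  from DERIV_imp_deriv[OF this] have 2: "deriv (\<lambda>y. \<psi> (y, t)) x = D (1, 0)" .
  have "D (1, -1) = D (1, 0) - D (0, 1)"
    using linear_diff[OF lin, of "(1, 0)" "(0, 1)"] by simp
  with 1 2 show ?thesis
    by (simp add: transport_derivative_def D_def)
qed

text \<open>
  The characteristic through the point \<open>y\<close> of the initial line is $t \mapsto (y - t, t)$; its
  direction is opposite to $(1, -1)$, which explains the sign.
\<close>

lemma DERIV_along_characteristic: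
  assumes "smooth \<psi>"
  shows "((\<lambda>t. \<psi> (y - t, t)) has_real_derivative - transport_derivative \<psi> (y - t, t)) (at t)"
proof -
  define D where "D = frechet_derivative \<psi> (at (y - t, t))"
  have D: "(\<psi> has_derivative D) (at (y - t, t))"
    using smooth_imp_differentiable[OF assms] by (simp add: D_def frechet_derivative_works[symmetric])
  have scale: "D (- v, v) = - D (1, -1) * v" for v
    using linear_cmul[OF has_derivative_linear[OF D], of "- v" "(1, -1)"] by (simp add: mult.commute)
  have "((\<lambda>t. (y - t, t)) has_derivative (\<lambda>h. (- h, h))) (at t)"
    using has_derivative_Pair[OF has_derivative_diff[OF has_derivative_const has_derivative_ident]
        has_derivative_ident, of y t UNIV] by simp
  from has_derivative_compose[OF this D]
  have "((\<lambda>t. \<psi> (y - t, t)) has_derivative (\<lambda>h. D (- h, h))) (at t)" .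
  moreover have "(\<lambda>h. D (- h, h)) = (*) (- transport_derivative \<psi> (y - t, t))"
    unfolding scale by (simp add: fun_eq_iff transport_derivative_def D_def)
  ultimately show ?thesis by (simp add: has_field_derivative_def)
qed

lemma continuous_transport_derivative:
  "smooth \<psi> \<Longrightarrow> continuous_on A (transport_derivative \<psi>)"
  unfolding transport_derivative_def
  by (rule smooth_imp_continuous[OF smooth_frechet_derivative])

lemma transport_derivative_eq_0:
  assumes "\<And>x t. t \<notin> {a..b} \<Longrightarrow> \<psi> (x, t) = 0" "t \<notin> {a..b}"
  shows "transport_derivative \<psi> (x, t) = 0"
proof -
  have "open ((UNIV :: real set) \<times> (- {a..b}))"
    by (intro open_Times) auto
  then have "(\<psi> has_derivative (\<lambda>v. 0)) (at (x, t))"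
    by (rule has_derivative_transform_within_open[OF has_derivative_const]) (use assms in auto)
  from transport_derivative_eq[OF this] show ?thesis .
qed

lemma wave_equation_iff:
  "wave_equation g u \<longleftrightarrow>
     (\<forall>\<psi>. cylinder_test_function \<psi> \<longrightarrow>
        (LINT (x, t):{0..2 * pi} \<times> {0..}|lborel. g x t * transport_derivative \<psi> (x, t))
        = (LINT t:{0..}|lborel. u t * \<psi> (0, t)))"
  unfolding wave_equation_def
proof (rule iff_allI, rule imp_cong[OF refl])
  fix \<psi> :: "real \<times> real \<Rightarrow> real" assume "cylinder_test_function \<psi>"
  then have \<psi>: "smooth \<psi>" by (simp add: cylinder_test_function_def)
  show
    "((LINT (x, t):{0..2 * pi} \<times> {0..}|lborel.
        g x t * (- deriv (\<lambda>s. \<psi> (x, s)) t + deriv (\<lambda>y. \<psi> (y, t)) x))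
      = (LINT t:{0..}|lborel. u t * \<psi> (0, t))) \<longleftrightarrow>
     ((LINT (x, t):{0..2 * pi} \<times> {0..}|lborel. g x t * transport_derivative \<psi> (x, t))
      = (LINT t:{0..}|lborel. u t * \<psi> (0, t)))"
    by (simp only: transport_derivative_partials[OF \<psi>])
qed

lemma cylinder_test_functionE:
  assumes "cylinder_test_function \<psi>"
  obtains a b where "smooth \<psi>" "\<And>t x. \<psi> (x + 2 * pi, t) = \<psi> (x, t)" "0 < a"
    "\<And>x t. t \<notin> {a..b} \<Longrightarrow> \<psi> (x, t) = 0"
  using assms unfolding cylinder_test_function_def circle_function_def by blast

text \<open>
  Linearity. The two sources need to agree only almost everywhere, so this also compares two
  solutions whose controls are merely known to coincide as classes.
\<close>

lemma wave_equation_diff: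
  assumes g: "locally_bounded_wave g" "wave_equation g u" "set_borel_measurable borel {0..} u"
    and h: "locally_bounded_wave h" "wave_equation h v" "set_borel_measurable borel {0..} v"
    and uv: "AE t in lborel. 0 \<le> t \<longrightarrow> u t = v t"
  shows "wave_equation (\<lambda>x t. g x t - h x t) (\<lambda>t. 0)"
  unfolding wave_equation_iff
proof (intro allI impI)
  fix \<psi> assume \<psi>: "cylinder_test_function \<psi>"
  then obtain a b where ab: "smooth \<psi>" "\<And>x t. t \<notin> {a..b} \<Longrightarrow> \<psi> (x, t) = 0"
    by (rule cylinder_test_functionE) blast
  let ?S = "{0..2 * pi} \<times> {0..}"
  have int: "set_integrable lborel ?S (\<lambda>(x, t). f x t * transport_derivative \<psi> (x, t))"
    if "locally_bounded_wave f" for f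
    by (rule set_integrable_wave[OF that continuous_transport_derivative[OF ab(1)], where a = a and b = b])
      (rule transport_derivative_eq_0[of a b \<psi>, OF ab(2)])
  have [measurable]: "(\<lambda>t. \<psi> (0, t)) \<in> borel_measurable borel"
    by (intro borel_measurable_continuous_onI continuous_on_compose2[OF smooth_imp_continuous[OF ab(1), of UNIV]]
        continuous_intros) auto
  have "(LINT (x, t):?S|lborel. (g x t - h x t) * transport_derivative \<psi> (x, t))
      = (LINT (x, t):?S|lborel. g x t * transport_derivative \<psi> (x, t))
        - (LINT (x, t):?S|lborel. h x t * transport_derivative \<psi> (x, t))"
    using set_integral_diff(2)[OF int[OF g(1)] int[OF h(1)]]
    by (simp only: case_prod_unfold left_diff_distrib)
  also have "\<dots> = (LINT t:{0..}|lborel. u t * \<psi> (0, t)) - (LINT t:{0..}|lborel. v t * \<psi> (0, t))"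
    using g(2) h(2) \<psi> by (simp add: wave_equation_iff)
  also have "(LINT t:{0..}|lborel. u t * \<psi> (0, t)) = (LINT t:{0..}|lborel. v t * \<psi> (0, t))"
    unfolding set_lebesgue_integral_def
  proof (rule integral_cong_AE)
    have "(\<lambda>t. (indicator {0..} t *\<^sub>R w t) * \<psi> (0, t)) \<in> borel_measurable lborel"
      if "set_borel_measurable borel {0..} w" for w
      using that unfolding set_borel_measurable_def by measurable
    with g(3) h(3) show "(\<lambda>t. indicator {0..} t *\<^sub>R (u t * \<psi> (0, t))) \<in> borel_measurable lborel"
      "(\<lambda>t. indicator {0..} t *\<^sub>R (v t * \<psi> (0, t))) \<in> borel_measurable lborel"
      by (simp_all add: mult.assoc)
    show "AE t in lborel. indicator {0..} t *\<^sub>R (u t * \<psi> (0, t)) = indicator {0..} t *\<^sub>R (v t * \<psi> (0, t))"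
      using uv by eventually_elim (auto simp: indicator_def)
  qed
  finally show "(LINT (x, t):?S|lborel. (g x t - h x t) * transport_derivative \<psi> (x, t))
      = (LINT t:{0..}|lborel. 0 * \<psi> (0, t))"
    by (simp add: set_lebesgue_integral_def)
qed

lemma continuous_into_distributions_diff:
  assumes g: "locally_bounded_wave g" "continuous_into_distributions g"
    and h: "locally_bounded_wave h" "continuous_into_distributions h"
  shows "continuous_into_distributions (\<lambda>x t. g x t - h x t)"
  unfolding continuous_into_distributions_def
proof (intro allI impI)
  fix \<psi> assume \<psi>: "circle_test_function \<psi>"
  have int: "set_integrable lborel {0..2 * pi} (\<lambda>x. f x t * \<psi> x)"
    if "locally_bounded_wave f" "0 \<le> t" for f t
  proof -
    have \<psi>': "continuous_on UNIV \<psi>"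
      using \<psi> by (auto simp: circle_test_function_def intro: smooth_imp_continuous)
    show ?thesis
      by (intro set_integrable_locally_bounded borel_measurable_times
          locally_bounded_mult[OF locally_bounded_wave_slice_bounded[OF that]
            locally_bounded_continuous[OF \<psi>']]
          locally_bounded_wave_slice_measurable[OF that] borel_measurable_continuous_onI[OF \<psi>'])
  qed
  have "continuous_on {0..} (\<lambda>t. (LINT x:{0..2 * pi}|lborel. g x t * \<psi> x)
      - (LINT x:{0..2 * pi}|lborel. h x t * \<psi> x))"
    using g(2) h(2) \<psi> unfolding continuous_into_distributions_def
    by (intro continuous_on_diff) auto
  then show "continuous_on {0..} (\<lambda>t. LINT x:{0..2 * pi}|lborel. (g x t - h x t) * \<psi> x)"
    by (rule continuous_on_eq)
      (auto simp: left_diff_distrib set_integral_diff(2)[OF int[OF g(1)] int[OF h(1)]])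
qed

section \<open>Uniqueness for the homogeneous equation\<close>

lemma circle_test_function_translate:
  assumes "circle_test_function \<psi>"
  shows "circle_test_function (\<lambda>x. \<psi> (x + c))"
proof -
  have "smooth (\<lambda>x::real. x + c)"
    by (intro smooth_add smooth_const smooth_bounded_linear bounded_linear_ident)
  from smooth_compose[OF _ this, of \<psi>] assms show ?thesis
    by (simp add: circle_test_function_def circle_function_def add.commute[of _ c] add.assoc[symmetric])
qed

text \<open>
  The moving test function changes the pairing by at most the integral of
  $|h|\,|\psi(x + s_n) - \psi(x + t)|$, which tends to \<open>0\<close> by dominated convergence; for a fixed
  test function continuity into distributions applies.
\<close>

lemma continuous_moving_frame_pairing:
  assumes h: "locally_bounded_wave h" "continuous_into_distributions h"
    and \<psi>: "circle_test_function \<psi>"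
  shows "continuous_on {0..} (\<lambda>t. LINT x:{0..2 * pi}|lborel. h x t * \<psi> (x + t))"
proof (rule continuous_on_sequentiallyI)
  fix s :: "nat \<Rightarrow> real" and t
  assume s: "\<forall>n. s n \<in> {0..}" and t: "t \<in> {0..}" and lim: "s \<longlonglongrightarrow> t"
  have c\<psi>: "continuous_on UNIV \<psi>"
    using \<psi> by (auto simp: circle_test_function_def intro: smooth_imp_continuous)
  have c\<psi>_shift: "continuous_on UNIV (\<lambda>x. \<psi> (x + c))" for c
    by (intro continuous_on_compose2[OF c\<psi>] continuous_intros) auto
  note [measurable] = borel_measurable_continuous_onI[OF c\<psi>]
  have int: "set_integrable lborel {0..2 * pi} (\<lambda>x. h x r * \<psi> (x + c))" if "0 \<le> r" for r c
    by (intro set_integrable_locally_bounded borel_measurable_times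
        locally_bounded_mult[OF locally_bounded_wave_slice_bounded[OF h(1) that]
          locally_bounded_continuous[OF c\<psi>_shift]]
        locally_bounded_wave_slice_measurable[OF h(1) that]
        borel_measurable_continuous_onI[OF c\<psi>_shift])
  obtain T where T: "\<And>n. \<bar>s n\<bar> \<le> T"
    using Bseq_bdd_above Bseq_def convergent_imp_Bseq[OF convergentI[OF lim]] by (metis real_norm_def)
  obtain C where C: "\<And>x r. 0 \<le> r \<Longrightarrow> r \<le> T \<Longrightarrow> \<bar>h x r\<bar> \<le> C" "0 \<le> C"
    using locally_bounded_waveD[OF h(1)] by metis
  define d where "d = (\<lambda>n x. \<psi> (x + s n) - \<psi> (x + t))"
  obtain M where M: "\<And>x. \<bar>x\<bar> \<le> 2 * pi + (T + \<bar>t\<bar>) \<Longrightarrow> \<bar>\<psi> x\<bar> \<le> M" "0 \<le> M"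
    using locally_boundedD[OF locally_bounded_continuous[OF c\<psi>]] by metis
  have slice[measurable]: "(\<lambda>x. h x (s n)) \<in> borel_measurable borel" for n
    using locally_bounded_wave_slice_measurable[OF h(1)] s by auto
  \<comment> \<open>The slices \<open>h x (s n)\<close> need not converge pointwise, but they stay bounded.\<close>
  have "(\<lambda>n. LINT x|lborel. indicator {0..2 * pi} x *\<^sub>R (h x (s n) * d n x)) \<longlonglongrightarrow>
      (LINT x|lborel. (\<lambda>x::real. 0::real) x)"
  proof (rule integral_dominated_convergence)
    show "integrable lborel (\<lambda>x::real. indicator {0..2 * pi} x *\<^sub>R (C * (2 * M)))"
      by (rule integrableI_bounded_set_indicator[where B = "C * (2 * M)"])
        (use C M in \<open>auto simp: emeasure_lborel_Icc_eq abs_mult\<close>)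
    show "AE x in lborel. norm (indicator {0..2 * pi} x *\<^sub>R (h x (s n) * d n x))
        \<le> indicator {0..2 * pi} x *\<^sub>R (C * (2 * M))" for n
    proof (rule AE_I2)
      fix x
      have "\<bar>h x (s n)\<bar> \<le> C"
        using C(1)[of "s n" x] s T[of n] by auto
      moreover have "\<bar>d n x\<bar> \<le> 2 * M" if "x \<in> {0..2 * pi}"
      proof -
        have "\<bar>\<psi> (x + s n)\<bar> \<le> M" "\<bar>\<psi> (x + t)\<bar> \<le> M"
          using T[of n] that by (intro M(1); auto)+
        then show ?thesis by (auto simp: d_def)
      qed
      ultimately show "norm (indicator {0..2 * pi} x *\<^sub>R (h x (s n) * d n x))
          \<le> indicator {0..2 * pi} x *\<^sub>R (C * (2 * M))"
        by (auto simp: indicator_def abs_mult intro!: mult_mono C M)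
    qed
    show "AE x in lborel. (\<lambda>n. indicator {0..2 * pi} x *\<^sub>R (h x (s n) * d n x)) \<longlonglongrightarrow> 0"
    proof (rule AE_I2)
      fix x
      have "isCont \<psi> (x + t)" using c\<psi> by (simp add: continuous_on_eq_continuous_at)
      then have "(\<lambda>n. \<psi> (x + s n)) \<longlonglongrightarrow> \<psi> (x + t)"
        by (rule isCont_tendsto_compose) (intro tendsto_intros lim)
      then have "(\<lambda>n. d n x) \<longlonglongrightarrow> 0"
        unfolding d_def by (rule LIM_zero)
      moreover have "Bfun (\<lambda>n. indicator {0..2 * pi} x * h x (s n)) sequentially"
      proof (rule BfunI[where K = C])
        have "\<bar>h x (s n)\<bar> \<le> C" for n
          using C(1)[of "s n" x] s T[of n] by auto
        then show "eventually (\<lambda>n. norm (indicator {0..2 * pi} x * h x (s n)) \<le> C) sequentially"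
          using C(2) by (auto simp: indicator_def)
      qed
      ultimately have "(\<lambda>n. d n x * (indicator {0..2 * pi} x * h x (s n))) \<longlonglongrightarrow> 0"
        using bounded_bilinear.Zfun_prod_Bfun[OF bounded_bilinear_mult] by (simp add: tendsto_Zfun_iff)
      then show "(\<lambda>n. indicator {0..2 * pi} x *\<^sub>R (h x (s n) * d n x)) \<longlonglongrightarrow> 0"
        by (simp add: mult_ac)
    qed
  qed (auto simp: d_def)
  then have 1: "(\<lambda>n. LINT x:{0..2 * pi}|lborel. h x (s n) * d n x) \<longlonglongrightarrow> 0"
    by (simp add: set_lebesgue_integral_def)
  have "continuous_on {0..} (\<lambda>r. LINT x:{0..2 * pi}|lborel. h x r * \<psi> (x + t))"
    using h(2) circle_test_function_translate[OF \<psi>, of t]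
    unfolding continuous_into_distributions_def by blast
  from continuous_on_tendsto_compose[OF this lim t] s
  have 2: "(\<lambda>n. LINT x:{0..2 * pi}|lborel. h x (s n) * \<psi> (x + t)) \<longlonglongrightarrow>
      (LINT x:{0..2 * pi}|lborel. h x t * \<psi> (x + t))" by simp
  have "(LINT x:{0..2 * pi}|lborel. h x (s n) * \<psi> (x + s n))
      = (LINT x:{0..2 * pi}|lborel. h x (s n) * \<psi> (x + t))
        + (LINT x:{0..2 * pi}|lborel. h x (s n) * d n x)" for n
  proof -
    have "0 \<le> s n" using s by auto
    from set_integral_diff(2)[OF int[OF this] int[OF this], of "s n" t] show ?thesis
      by (simp add: d_def right_diff_distrib)
  qed
  with tendsto_add[OF 2 1]
  show "(\<lambda>n. LINT x:{0..2 * pi}|lborel. h x (s n) * \<psi> (x + s n)) \<longlonglongrightarrow>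
      (LINT x:{0..2 * pi}|lborel. h x t * \<psi> (x + t))" by simp
qed

text \<open>
  The factor $\psi(x + t)$ is constant along characteristics, so the transport derivative of the
  test function $\psi(x+t)\eta(t)$ is $-\psi(x+t)\eta'(t)$. The wave equation therefore says that
  the pairing has weak derivative zero in time.
\<close>

lemma homogeneous_wave_moving_frame_pairing:
  assumes h: "locally_bounded_wave h" "continuous_into_distributions h" "wave_equation h (\<lambda>t. 0)"
    and \<psi>: "circle_test_function \<psi>" and t: "0 \<le> t"
  shows "(LINT x:{0..2 * pi}|lborel. h x t * \<psi> (x + t)) = (LINT x:{0..2 * pi}|lborel. h x 0 * \<psi> x)"
proof -
  define A where "A = (\<lambda>t. LINT x:{0..2 * pi}|lborel. h x t * \<psi> (x + t))"
  \<comment> \<open>The pairing is defined on the half line only; its constant extension is continuous on the line.\<close>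
  define B where "B = (\<lambda>t. A (max 0 t))"
  have sm\<psi>: "smooth \<psi>" using \<psi> by (simp add: circle_test_function_def)
  have "continuous_on {0..} A"
    unfolding A_def by (rule continuous_moving_frame_pairing[OF h(1,2) \<psi>])
  then have B: "continuous_on UNIV B"
    unfolding B_def by (rule continuous_on_compose2) (auto intro!: continuous_intros)
  have "B t = B 0"
  proof (rule continuous_eq_initial_value_if_weak_derivative_0[OF B _ t])
    fix \<eta> :: "real \<Rightarrow> real" and a b :: real
    assume \<eta>: "smooth \<eta>" "0 < a" and supp: "\<And>t. t \<notin> {a..b} \<Longrightarrow> \<eta> t = 0"
    define \<Psi> where "\<Psi> = (\<lambda>p. \<psi> (fst p + snd p) * \<eta> (snd p))"
    have "smooth \<Psi>"
      unfolding \<Psi>_def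
      by (rule smooth_mult[OF smooth_compose[OF sm\<psi>] smooth_compose[OF \<eta>(1)]])
        (auto intro!: smooth_bounded_linear smooth_add bounded_linear_add bounded_linear_fst bounded_linear_snd)
    moreover have "circle_function (\<lambda>x. \<Psi> (x, t))" for t
      unfolding circle_function_def
    proof
      fix x
      have "\<psi> ((x + t) + 2 * pi) = \<psi> (x + t)"
        using \<psi> unfolding circle_test_function_def circle_function_def by blast
      then show "\<Psi> (x + 2 * pi, t) = \<Psi> (x, t)"
        by (simp add: \<Psi>_def add_ac)
    qed
    moreover have "\<Psi> (x, t) = 0" if "t \<notin> {a..b}" for x t
      unfolding \<Psi>_def snd_conv supp[OF that] by (rule mult_zero_right)
    ultimately have \<Psi>: "cylinder_test_function \<Psi>"
      unfolding cylinder_test_function_def using \<open>0 < a\<close> by blast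
    have tr: "transport_derivative \<Psi> (x, t) = - (\<psi> (x + t) * deriv \<eta> t)" for x t
    proof -
      have s: "((\<lambda>p. fst p + snd p) has_derivative (\<lambda>v. fst v + snd v)) (at (x, t))"
        by (intro has_derivative_add has_derivative_fst has_derivative_snd has_derivative_ident)
      have "(\<psi> has_derivative (*) (deriv \<psi> (x + t))) (at (fst (x, t) + snd (x, t)))"
        using smooth_DERIV[OF sm\<psi>, of "x + t"] by (simp add: has_field_derivative_def)
      from has_derivative_compose[OF s this]
      have 1: "((\<lambda>p. \<psi> (fst p + snd p)) has_derivative (\<lambda>v. deriv \<psi> (x + t) * (fst v + snd v))) (at (x, t))" .
      have "(\<eta> has_derivative (*) (deriv \<eta> t)) (at (snd (x, t)))"
        using smooth_DERIV[OF \<eta>(1), of t] by (simp add: has_field_derivative_def)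
      from has_derivative_compose[OF has_derivative_snd[OF has_derivative_ident] this]
      have 2: "((\<lambda>p. \<eta> (snd p)) has_derivative (\<lambda>v. deriv \<eta> t * snd v)) (at (x, t))" .
      from transport_derivative_eq[OF has_derivative_mult[OF 1 2]] show ?thesis
        by (simp add: \<Psi>_def)
    qed
    have "0 = (LINT (x, t):{0..2 * pi} \<times> {0..}|lborel. h x t * transport_derivative \<Psi> (x, t))"
      using h(3) \<Psi> by (simp add: wave_equation_iff)
    also have "\<dots> = (LINT t:{0..}|lborel. LINT x:{0..2 * pi}|lborel. h x t * transport_derivative \<Psi> (x, t))"
      by (rule wave_integral_Fubini[OF h(1) continuous_transport_derivative[OF \<open>smooth \<Psi>\<close>],
            where a = a and b = b])
        (rule transport_derivative_eq_0[of a b], auto simp: \<Psi>_def supp)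
    also have "\<dots> = (LINT t:{0..}|lborel. - (deriv \<eta> t * A t))"
    proof -
      have e: "h x t * transport_derivative \<Psi> (x, t) = - deriv \<eta> t * (h x t * \<psi> (x + t))" for x t
        by (simp add: tr)
      show ?thesis unfolding A_def e set_integral_mult_right by simp
    qed
    also have "\<dots> = - (LINT t|lborel. deriv \<eta> t * B t)"
      unfolding set_lebesgue_integral_def integral_minus[symmetric]
    proof (rule Bochner_Integration.integral_cong[OF refl])
      fix t
      have "deriv \<eta> t = 0" if "t < 0"
      proof -
        have "(\<eta> has_real_derivative 0) (at t)"
          by (rule has_field_derivative_transform_within_open[OF DERIV_const, of "{..<0}"])
            (use that supp \<open>0 < a\<close> in auto)
        then show ?thesis by (rule DERIV_imp_deriv)
      qed
      then show "indicator {0..} t *\<^sub>R - (deriv \<eta> t * A t) = - (deriv \<eta> t * B t)"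
        by (cases "t < 0") (auto simp: indicator_def B_def)
    qed
    finally show "(LINT t|lborel. deriv \<eta> t * B t) = 0" by simp
  qed
  then show ?thesis using t by (simp add: B_def A_def)
qed

text \<open>
  Translating the test function back shows that the slice at time \<open>t\<close> annihilates every circle
  test function.
\<close>

lemma homogeneous_wave_eq_0:
  assumes h: "locally_bounded_wave h" "continuous_into_distributions h" "wave_equation h (\<lambda>t. 0)"
    and init: "AE x in lborel. h x 0 = 0" and t: "0 \<le> t"
  shows "AE x in lborel. h x t = 0"
proof -
  have "(LINT x:{0..2 * pi}|lborel. h x t * \<psi> x) = 0" if "circle_test_function \<psi>" for \<psi>
  proof -
    from homogeneous_wave_moving_frame_pairing[OF h circle_test_function_translate[OF that, of "- t"] t]
    have "(LINT x:{0..2 * pi}|lborel. h x t * \<psi> x) = (LINT x:{0..2 * pi}|lborel. h x 0 * \<psi> (x + - t))"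
      by simp
    also have "\<dots> = 0"
      unfolding set_lebesgue_integral_def
    proof (rule integral_eq_zero_AE)
      show "AE x in lborel. indicator {0..2 * pi} x *\<^sub>R (h x 0 * \<psi> (x + - t)) = 0"
        using init by eventually_elim simp
    qed
    finally show ?thesis .
  qed
  then have "AE x in lborel. x \<in> {0..2 * pi} \<longrightarrow> h x t = 0"
    by (rule AE_eq_0_if_orthogonal_to_test_functions[OF locally_bounded_wave_slice_measurable[OF h(1) t]
          locally_bounded_wave_slice_bounded[OF h(1) t]])
  then show ?thesis
    by (rule AE_periodicI)
      (use h(1) t in \<open>simp add: locally_bounded_wave_def circle_function_def\<close>)
qed

section \<open>Profile waves\<close>

lemma circle_rep_periodic: "circle_rep (x + 2 * pi) = circle_rep x"
proof -
  have "(x + 2 * pi) / (2 * pi) = x / (2 * pi) + 1" by (simp add: add_divide_distrib)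
  then have "\<lfloor>(x + 2 * pi) / (2 * pi)\<rfloor> = \<lfloor>x / (2 * pi)\<rfloor> + 1" by simp
  then show ?thesis by (simp add: circle_rep_def algebra_simps)
qed

lemma circle_rep_eq: "0 \<le> x \<Longrightarrow> x < 2 * pi \<Longrightarrow> circle_rep x = x"
proof -
  assume "0 \<le> x" "x < 2 * pi"
  then have "\<lfloor>x / (2 * pi)\<rfloor> = 0" by (simp add: floor_eq_iff)
  then show ?thesis by (simp add: circle_rep_def)
qed

lemma borel_circle_rep [measurable]: "circle_rep \<in> borel_measurable borel"
  unfolding circle_rep_def by measurable

text \<open>
  The d'Alembert solution: on the fundamental domain $0 \le x < 2\pi$ it is $K(x + t)$, and the
  value $K(t + 2\pi)$ that is reached at the right end is the trace from the left of the origin.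
\<close>

definition profile_wave :: "(real \<Rightarrow> real) \<Rightarrow> real \<Rightarrow> real \<Rightarrow> real" where
  "profile_wave K x t = K (circle_rep x + t)"

lemma locally_bounded_wave_profile:
  assumes [measurable]: "K \<in> borel_measurable borel" and "locally_bounded K"
  shows "locally_bounded_wave (profile_wave K)"
  unfolding locally_bounded_wave_def
proof (intro conjI allI impI)
  show "circle_function (\<lambda>x. profile_wave K x t)" for t
    by (simp add: circle_function_def profile_wave_def circle_rep_periodic)
  have "(\<lambda>p. K (circle_rep (fst p) + snd p)) \<in> borel_measurable (borel \<Otimes>\<^sub>M borel)"
    by measurable
  moreover have "(UNIV :: real set) \<times> {0::real..} \<in> sets (borel :: (real \<times> real) measure)"
    by (intro borel_closed closed_Times) auto
  ultimately have "(\<lambda>p. indicator (UNIV \<times> {0..}) p *\<^sub>R K (circle_rep (fst p) + snd p)) \<in> borel_measurable borel"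
    unfolding borel_prod by measurable
  then show "set_borel_measurable borel (UNIV \<times> {0..}) (\<lambda>(x, t). profile_wave K x t)"
    by (simp add: set_borel_measurable_def profile_wave_def case_prod_unfold)
  fix T
  obtain C where C: "\<And>x. \<bar>x\<bar> \<le> 2 * pi + T \<Longrightarrow> \<bar>K x\<bar> \<le> C"
    using locally_boundedD[OF assms(2)] by metis
  show "\<exists>C. \<forall>x. \<forall>t\<in>{0..T}. \<bar>profile_wave K x t\<bar> \<le> C"
  proof (intro exI[of _ C] allI ballI)
    fix x t assume "t \<in> {0..T}"
    with circle_rep_bounds[of x] show "\<bar>profile_wave K x t\<bar> \<le> C"
      unfolding profile_wave_def by (intro C) auto
  qed
qed

text \<open>
  In the variable $y = x + t$ the integrand depends on time only through the test function and the
  window of integration.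
\<close>

lemma profile_wave_integral:
  assumes [measurable]: "K \<in> borel_measurable borel" "f \<in> borel_measurable borel"
  shows "(LINT x:{0..2 * pi}|lborel. profile_wave K x t * f x)
    = (LINT y|lborel. indicator {t..t + 2 * pi} y * (K y * f (y - t)))"
proof -
  have "AE x in lborel. x \<noteq> 2 * pi" by (rule AE_lborel_singleton)
  then have "AE x in lborel. indicator {0..2 * pi} x *\<^sub>R (profile_wave K x t * f x)
      = indicator {0..2 * pi} x * (K (x + t) * f x)"
    by eventually_elim (auto simp: indicator_def profile_wave_def circle_rep_eq)
  then have "(LINT x:{0..2 * pi}|lborel. profile_wave K x t * f x)
      = (LINT x|lborel. indicator {0..2 * pi} x * (K (x + t) * f x))"
    unfolding set_lebesgue_integral_def
    by (intro integral_cong_AE) (simp_all add: profile_wave_def)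
  also have "\<dots> = (LINT y|lborel. indicator {t..t + 2 * pi} y * (K y * f (y - t)))"
    by (subst lborel_integral_real_affine[of 1 _ "- t"])
      (auto simp: indicator_def intro!: Bochner_Integration.integral_cong)
  finally show ?thesis .
qed

lemma continuous_into_distributions_profile:
  assumes K[measurable]: "K \<in> borel_measurable borel" and lb: "locally_bounded K"
  shows "continuous_into_distributions (profile_wave K)"
  unfolding continuous_into_distributions_def
proof (intro allI impI continuous_on_sequentiallyI)
  fix \<psi> and s :: "nat \<Rightarrow> real" and t
  assume \<psi>: "circle_test_function \<psi>" and lim: "s \<longlonglongrightarrow> t"
  have c\<psi>: "continuous_on UNIV \<psi>"
    using \<psi> by (auto simp: circle_test_function_def intro: smooth_imp_continuous)
  note [measurable] = borel_measurable_continuous_onI[OF c\<psi>]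
  obtain T where T: "\<And>n. \<bar>s n\<bar> \<le> T"
    using Bseq_bdd_above Bseq_def convergent_imp_Bseq[OF convergentI[OF lim]] by (metis real_norm_def)
  obtain C where C: "\<And>x. \<bar>x\<bar> \<le> T + 2 * pi \<Longrightarrow> \<bar>K x\<bar> \<le> C" "0 \<le> C"
    using locally_boundedD[OF lb] by metis
  obtain M where M: "\<And>x. \<bar>x\<bar> \<le> 2 * pi \<Longrightarrow> \<bar>\<psi> x\<bar> \<le> M" "0 \<le> M"
    using locally_boundedD[OF locally_bounded_continuous[OF c\<psi>]] by metis
  define f where "f = (\<lambda>r y. indicator {r..r + 2 * pi} y * (K y * \<psi> (y - r)))"
  have "(\<lambda>n. LINT y|lborel. f (s n) y) \<longlonglongrightarrow> (LINT y|lborel. f t y)"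
  proof (rule integral_dominated_convergence)
    show "integrable lborel (\<lambda>y::real. indicator {- T..T + 2 * pi} y *\<^sub>R (C * M))"
      by (rule integrableI_bounded_set_indicator[where B = "C * M"])
        (use C M in \<open>auto simp: emeasure_lborel_Icc_eq abs_mult\<close>)
    show "AE y in lborel. norm (f (s n) y) \<le> indicator {- T..T + 2 * pi} y *\<^sub>R (C * M)" for n
    proof (rule AE_I2)
      fix y
      show "norm (f (s n) y) \<le> indicator {- T..T + 2 * pi} y *\<^sub>R (C * M)"
      proof (cases "y \<in> {s n..s n + 2 * pi}")
        case True
        then have y: "y \<in> {- T..T + 2 * pi}" using T[of n] by auto
        have "\<bar>K y\<bar> \<le> C" by (rule C) (use y pi_gt_zero in \<open>unfold atLeastAtMost_iff, arith\<close>)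
        moreover have "\<bar>\<psi> (y - s n)\<bar> \<le> M" by (rule M) (use True in auto)
        ultimately show ?thesis
          using True y C(2) by (auto simp: f_def abs_mult intro!: mult_mono)
      next
        case False
        then show ?thesis using C(2) M(2) by (simp add: f_def)
      qed
    qed
    have "AE y in lborel. y \<noteq> t \<and> y \<noteq> t + 2 * pi"
      using AE_lborel_singleton[of t] AE_lborel_singleton[of "t + 2 * pi"] by eventually_elim auto
    then show "AE y in lborel. (\<lambda>n. f (s n) y) \<longlonglongrightarrow> f t y"
    proof eventually_elim
      case (elim y)
      have "eventually (\<lambda>n. (indicator {s n..s n + 2 * pi} y :: real) = indicator {t..t + 2 * pi} y) sequentially"
      proof -
        have 1: "eventually (\<lambda>n. (s n \<le> y) = (t \<le> y)) sequentially"
        proof (cases "t < y")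
          case True
          from order_tendstoD(2)[OF lim True] show ?thesis
            by eventually_elim (use True in auto)
        next
          case False
          with elim have "y < t" by auto
          from order_tendstoD(1)[OF lim this] show ?thesis
            by eventually_elim (use \<open>y < t\<close> in auto)
        qed
        have 2: "eventually (\<lambda>n. (y - 2 * pi \<le> s n) = (y - 2 * pi \<le> t)) sequentially"
        proof (cases "t < y - 2 * pi")
          case True
          from order_tendstoD(2)[OF lim True] show ?thesis
            by eventually_elim (use True in auto)
        next
          case False
          with elim have "y - 2 * pi < t" by auto
          from order_tendstoD(1)[OF lim this] show ?thesis
            by eventually_elim (use \<open>y - 2 * pi < t\<close> in auto)
        qed
        from 1 2 show ?thesis by eventually_elim (simp add: indicator_def algebra_simps)
      qed
      then have "(\<lambda>n. indicator {s n..s n + 2 * pi} y :: real) \<longlonglongrightarrow> indicator {t..t + 2 * pi} y"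
        by (rule tendsto_eventually)
      moreover have "isCont \<psi> (y - t)" using c\<psi> by (simp add: continuous_on_eq_continuous_at)
      then have "(\<lambda>n. \<psi> (y - s n)) \<longlonglongrightarrow> \<psi> (y - t)"
        by (rule isCont_tendsto_compose) (intro tendsto_intros lim)
      ultimately show ?case
        unfolding f_def by (intro tendsto_mult tendsto_const)
    qed
  qed (auto simp: f_def)
  then show "(\<lambda>n. LINT x:{0..2 * pi}|lborel. profile_wave K x (s n) * \<psi> x) \<longlonglongrightarrow>
      (LINT x:{0..2 * pi}|lborel. profile_wave K x t * \<psi> x)"
    by (simp add: profile_wave_integral f_def)
qed

lemma integrable_locally_bounded_support:
  assumes "f \<in> borel_measurable borel" "locally_bounded f" "\<And>x. x \<notin> {a..b} \<Longrightarrow> f x = 0"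
  shows "integrable lborel f"
proof -
  have "(\<lambda>x. indicator {a..b} x *\<^sub>R f x) = f"
    using assms(3) by (auto simp: fun_eq_iff indicator_def)
  with set_integrable_locally_bounded[OF assms(1,2), of a b] show ?thesis
    by (simp add: set_integrable_def)
qed

text \<open>
  In the variables $y = x + t$ and \<open>t\<close> the profile \<open>K\<close> does not depend on time, so the inner
  integral over \<open>t\<close> is the integral of a derivative along the characteristic through \<open>y\<close>. This
  characteristic enters the strip at \<open>x = 2 * pi\<close>, or at \<open>t = 0\<close> if $y < 2\pi$, and leaves it at
  \<open>x = 0\<close> at time \<open>y\<close>. The boundary terms compare \<open>K\<close> with its translate by one period, and
  their difference is \<open>u\<close>.
\<close>

lemma wave_equation_profile:
  assumes K[measurable]: "K \<in> borel_measurable borel" and lb: "locally_bounded K"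
    and jump: "\<And>t. 0 \<le> t \<Longrightarrow> K (t + 2 * pi) = K t + u t"
  shows "wave_equation (profile_wave K) u"
  unfolding wave_equation_iff
proof (intro allI impI)
  fix \<psi> assume "cylinder_test_function \<psi>"
  then obtain a b where \<psi>: "smooth \<psi>" "\<And>t x. \<psi> (x + 2 * pi, t) = \<psi> (x, t)" "0 < a"
    "\<And>x t. t \<notin> {a..b} \<Longrightarrow> \<psi> (x, t) = 0"
    by (rule cylinder_test_functionE) blast
  define D where "D = transport_derivative \<psi>"
  have D: "continuous_on UNIV D"
    unfolding D_def by (rule continuous_transport_derivative[OF \<psi>(1)])
  have D0: "D (x, t) = 0" if "t \<notin> {a..b}" for x t
    unfolding D_def using \<psi>(4) that by (rule transport_derivative_eq_0)
  have "continuous_on UNIV (\<lambda>p. D (fst p - snd p, snd p))"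
    by (rule continuous_on_compose2[OF D]) (auto intro!: continuous_intros)
  then have [measurable]: "(\<lambda>p. D (fst p - snd p, snd p)) \<in> borel_measurable (borel \<Otimes>\<^sub>M borel)"
    unfolding borel_prod by (rule borel_measurable_continuous_onI)
  define F where "F = (\<lambda>y t. indicator {0..} t * (indicator {t..t + 2 * pi} y * (K y * D (y - t, t))))"
  have int: "integrable lborel (\<lambda>y. K y * \<psi> (0, y - c))" for c
  proof (rule integrable_locally_bounded_support)
    have c: "continuous_on UNIV (\<lambda>y. \<psi> (0, y - c))"
      by (rule continuous_on_compose2[OF smooth_imp_continuous[OF \<psi>(1), of UNIV]])
        (auto intro!: continuous_intros)
    show "(\<lambda>y. K y * \<psi> (0, y - c)) \<in> borel_measurable borel"
      by (rule borel_measurable_times[OF K borel_measurable_continuous_onI[OF c]])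
    show "locally_bounded (\<lambda>y. K y * \<psi> (0, y - c))"
      by (rule locally_bounded_mult[OF lb locally_bounded_continuous[OF c]])
    show "K y * \<psi> (0, y - c) = 0" if "y \<notin> {a + c..b + c}" for y
      using \<psi>(4)[of "y - c" 0] that by auto
  qed
  have "(LINT (x, t):{0..2 * pi} \<times> {0..}|lborel. profile_wave K x t * D (x, t))
      = (LINT t:{0..}|lborel. LINT x:{0..2 * pi}|lborel. profile_wave K x t * D (x, t))"
    by (rule wave_integral_Fubini[OF locally_bounded_wave_profile[OF K lb] D, where a = a and b = b])
      (rule D0)
  also have "\<dots> = (LINT t|lborel. LINT y|lborel. F y t)"
    unfolding set_lebesgue_integral_def[of lborel "{0..}"]
  proof (rule Bochner_Integration.integral_cong[OF refl])
    show "indicator {0..} t *\<^sub>R (LINT x:{0..2 * pi}|lborel. profile_wave K x t * D (x, t))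
        = (LINT y|lborel. F y t)" for t
    proof -
      have "continuous_on UNIV (\<lambda>x. D (x, t))"
        by (rule continuous_on_compose2[OF D]) (auto intro!: continuous_intros)
      from profile_wave_integral[OF K borel_measurable_continuous_onI[OF this]]
      show ?thesis by (simp add: F_def)
    qed
  qed
  also have "\<dots> = (LINT y|lborel. LINT t|lborel. F y t)"
  proof (rule lborel_pair.Fubini_integral)
    obtain C where C: "\<And>x. \<bar>x\<bar> \<le> b + 2 * pi \<Longrightarrow> \<bar>K x\<bar> \<le> C" "0 \<le> C"
      using locally_boundedD[OF lb] by metis
    have "compact (D ` ({0..2 * pi} \<times> {0..b}))"
      by (intro compact_continuous_image continuous_on_subset[OF D] compact_Times) auto
    then obtain M where M: "\<And>x t. x \<in> {0..2 * pi} \<Longrightarrow> t \<in> {0..b} \<Longrightarrow> \<bar>D (x, t)\<bar> \<le> M"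
      by (force simp: bounded_iff dest!: compact_imp_bounded)
    have F0: "F y t = 0" if "(y, t) \<notin> cbox (0, 0) (b + 2 * pi, b)" for y t
      using that D0[of t "y - t"] by (auto simp: F_def indicator_def cbox_Pair_eq)
    have FM: "\<bar>F y t\<bar> \<le> C * M" if "(y, t) \<in> cbox (0, 0) (b + 2 * pi, b)" for y t
    proof (cases "y \<in> {t..t + 2 * pi}")
      case True
      from that have yt: "0 \<le> y" "y \<le> b + 2 * pi" "0 \<le> t" "t \<le> b" by (auto simp: cbox_Pair_eq)
      have "\<bar>K y\<bar> \<le> C" by (rule C) (use yt in auto)
      moreover have "\<bar>D (y - t, t)\<bar> \<le> M" by (rule M) (use True yt in auto)
      ultimately show ?thesis
        using True yt C(2) by (auto simp: F_def abs_mult intro!: mult_mono)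
    next
      case False
      have "0 \<le> M" using M[of 0 0] that by (auto simp: cbox_Pair_eq)
      with False C(2) show ?thesis by (simp add: F_def)
    qed
    show "integrable (lborel \<Otimes>\<^sub>M lborel) (\<lambda>(y, t). F y t)"
      unfolding lborel_prod
    proof (rule integrableI_bounded_set[where A = "cbox (0, 0) (b + 2 * pi, b)" and B = "C * M"])
      have "(\<lambda>(y, t). F y t) \<in> borel_measurable (borel \<Otimes>\<^sub>M borel)"
        unfolding F_def indicator_def atLeastAtMost_iff atLeast_iff case_prod_unfold by measurable
      then show "(\<lambda>(y, t). F y t) \<in> borel_measurable lborel"
        by (simp add: borel_prod)
      show "emeasure lborel (cbox (0, 0) (b + 2 * pi, b)) < \<infinity>"
        by (rule emeasure_lborel_cbox_finite)
      show "AE p in lborel. p \<in> cbox (0, 0) (b + 2 * pi, b) \<longrightarrow> norm (case p of (y, t) \<Rightarrow> F y t) \<le> C * M"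
        by (rule AE_I2) (simp add: FM case_prod_unfold)
      show "AE p in lborel. p \<notin> cbox (0, 0) (b + 2 * pi, b) \<longrightarrow> (case p of (y, t) \<Rightarrow> F y t) = 0"
        by (rule AE_I2) (simp add: F0 case_prod_unfold)
    qed simp
  qed
  also have "\<dots> = (LINT y|lborel. K y * \<psi> (0, y - 2 * pi) - K y * \<psi> (0, y))"
  proof (rule Bochner_Integration.integral_cong[OF refl])
    fix y
    \<comment> \<open>The time at which the characteristic through \<open>y\<close> enters the strip.\<close>
    define m where "m = max 0 (y - 2 * pi)"
    have F: "F y t = K y * (D (y - t, t) * indicator {m..y} t)" for t
      by (auto simp: F_def m_def indicator_def)
    have \<psi>0: "\<psi> (x, t) = 0" if "t \<le> 0" for x t
      using \<psi>(3) \<psi>(4)[of t x] that by auto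
    show "(LINT t|lborel. F y t) = K y * \<psi> (0, y - 2 * pi) - K y * \<psi> (0, y)"
    proof (cases "0 \<le> y")
      case True
      then have "m \<le> y" by (simp add: m_def)
      have der: "((\<lambda>t. - \<psi> (y - t, t)) has_real_derivative D (y - t, t)) (at t)" for t
        using DERIV_minus[OF DERIV_along_characteristic[OF \<psi>(1)]] by (simp add: D_def)
      have "continuous_on UNIV (\<lambda>t. D (y - t, t))"
        by (rule continuous_on_compose2[OF D]) (auto intro!: continuous_intros)
      then have "isCont (\<lambda>t. D (y - t, t)) t" for t
        by (simp add: continuous_on_eq_continuous_at)
      from integral_FTC_Icc_real[OF \<open>m \<le> y\<close> der this]
      have "(LINT t|lborel. D (y - t, t) * indicator {m..y} t) = \<psi> (y - m, m) - \<psi> (0, y)"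
        by simp
      \<comment> \<open>Entry at \<open>t = 0\<close> contributes nothing since \<open>\<psi>\<close> is supported in positive times.\<close>
      moreover have "\<psi> (y - m, m) = \<psi> (0, y - 2 * pi)"
        using \<psi>(2)[of 0 m] by (cases "y \<le> 2 * pi") (auto simp: m_def \<psi>0 max_def)
      ultimately show ?thesis by (simp add: F right_diff_distrib)
    next
      case False
      then have "{m..y} = {}" by (auto simp: m_def)
      moreover have "y - 2 * pi \<le> 0" using False pi_gt_zero by linarith
      ultimately show ?thesis using False by (simp add: F \<psi>0)
    qed
  qed
  also have "\<dots> = (LINT y|lborel. K y * \<psi> (0, y - 2 * pi)) - (LINT y|lborel. K y * \<psi> (0, y))"
    using int[of "2 * pi"] int[of 0] by (simp add: Bochner_Integration.integral_diff)
  also have "(LINT y|lborel. K y * \<psi> (0, y - 2 * pi)) = (LINT y|lborel. K (2 * pi + y) * \<psi> (0, y))"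
    by (subst lborel_integral_real_affine[of 1 _ "2 * pi"]) auto
  also have "\<dots> - (LINT y|lborel. K y * \<psi> (0, y))
      = (LINT y|lborel. K (2 * pi + y) * \<psi> (0, y) - K y * \<psi> (0, y))"
    using lborel_integrable_real_affine[OF int[of "2 * pi"], of 1 "2 * pi"] int[of 0]
    by (simp add: Bochner_Integration.integral_diff)
  also have "\<dots> = (LINT t:{0..}|lborel. u t * \<psi> (0, t))"
    unfolding set_lebesgue_integral_def
  proof (rule Bochner_Integration.integral_cong[OF refl])
    fix y
    show "K (2 * pi + y) * \<psi> (0, y) - K y * \<psi> (0, y) = indicator {0..} y *\<^sub>R (u y * \<psi> (0, y))"
    proof (cases "0 \<le> y")
      case True
      with jump[of y] show ?thesis by (simp add: add.commute[of _ y] algebra_simps)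
    next
      case False
      then have "\<psi> (0, y) = 0" using \<psi>(3) \<psi>(4)[of y 0] by auto
      then show ?thesis by simp
    qed
  qed
  finally show "(LINT (x, t):{0..2 * pi} \<times> {0..}|lborel. profile_wave K x t * transport_derivative \<psi> (x, t))
      = (LINT t:{0..}|lborel. u t * \<psi> (0, t))"
    by (simp add: D_def)
qed

section \<open>The averaged value at the origin\<close>

text \<open>
  To the right of the origin the wave has the profile near \<open>t\<close>, and to the left of it the profile
  near $t + 2\pi$. One-sided Lebesgue differentiation at these two points gives the two halves.
\<close>

lemma symmetric_mean_tendsto_average:
  assumes g: "locally_bounded_wave g"
    and K[measurable]: "K \<in> borel_measurable borel" and lb: "locally_bounded K"
    and eq: "\<And>t. 0 \<le> t \<Longrightarrow> AE x in lborel. g x t = profile_wave K x t"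
  shows "AE t in lborel. 0 \<le> t \<longrightarrow>
    (symmetric_mean (\<lambda>x. g x t) \<longlongrightarrow> (K t + K (t + 2 * pi)) / 2) (at_right 0)"
proof -
  have "AE t in lborel. ((\<lambda>\<epsilon>. (LBINT y:{2 * pi + t - \<epsilon>..2 * pi + t}. K y) / \<epsilon>) \<longlongrightarrow> K (2 * pi + t)) (at_right 0)"
    by (rule AE_shift[OF lebesgue_differentiation_left[OF K lb]])
  with lebesgue_differentiation_right[OF K lb] show ?thesis
  proof eventually_elim
    case (elim t)
    show ?case
    proof
      assume t: "0 \<le> t"
      have [measurable]: "(\<lambda>x. g x t) \<in> borel_measurable borel"
        by (rule locally_bounded_wave_slice_measurable[OF g t])
      have mean: "symmetric_mean (\<lambda>x. g x t) \<epsilon> =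
          ((LBINT y:{t..t + \<epsilon>}. K y) / \<epsilon> + (LBINT y:{2 * pi + t - \<epsilon>..2 * pi + t}. K y) / \<epsilon>) / 2"
        if \<epsilon>: "0 < \<epsilon>" "\<epsilon> < 2 * pi" for \<epsilon>
      proof -
        have int: "integrable lborel (\<lambda>y. indicator {a..b} y * K y)" for a b
          using set_integrable_locally_bounded[OF K lb, of a b] by (simp add: set_integrable_def)
        \<comment> \<open>The two intervals of integration share the origin, where the splitting fails.\<close>
        have "AE x in lborel. x \<noteq> (0::real)" by (rule AE_lborel_singleton)
        with eq[OF t] have "AE x in lborel. indicator {- \<epsilon>..\<epsilon>} x *\<^sub>R g x t
            = indicator {t..t + \<epsilon>} (t + x) * K (t + x)
              + indicator {2 * pi + t - \<epsilon>..2 * pi + t} (2 * pi + t + x) * K (2 * pi + t + x)"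
        proof eventually_elim
          case (elim x)
          consider "x < - \<epsilon>" | "- \<epsilon> \<le> x" "x < 0" | "0 < x" "x \<le> \<epsilon>" | "\<epsilon> < x"
            using elim(2) by linarith
          then show ?case
          proof cases
            case 2
            with \<epsilon> have "circle_rep x = x + 2 * pi"
              using circle_rep_periodic[of x] circle_rep_eq[of "x + 2 * pi"] by simp
            with elim(1) have "g x t = K (2 * pi + t + x)"
              by (simp add: profile_wave_def add_ac)
            with 2 show ?thesis by (simp add: indicator_def)
          next
            case 3
            with \<epsilon> have "circle_rep x = x" by (intro circle_rep_eq) auto
            with elim(1) have "g x t = K (t + x)"
              by (simp add: profile_wave_def add_ac)
            with 3 show ?thesis by (simp add: indicator_def)
          qed (use \<epsilon> in \<open>auto simp: indicator_def\<close>)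
        qed
        then have "(LBINT x:{- \<epsilon>..\<epsilon>}. g x t)
            = (LBINT x. indicator {t..t + \<epsilon>} (t + x) * K (t + x)
              + indicator {2 * pi + t - \<epsilon>..2 * pi + t} (2 * pi + t + x) * K (2 * pi + t + x))"
          unfolding set_lebesgue_integral_def by (intro integral_cong_AE) simp_all
        also have "\<dots> = (LBINT x. indicator {t..t + \<epsilon>} (t + 1 * x) * K (t + 1 * x))
            + (LBINT x. indicator {2 * pi + t - \<epsilon>..2 * pi + t} (2 * pi + t + 1 * x) * K (2 * pi + t + 1 * x))"
          using lborel_integrable_real_affine[OF int[of t "t + \<epsilon>"], of 1 t]
            lborel_integrable_real_affine[OF int[of "2 * pi + t - \<epsilon>" "2 * pi + t"], of 1 "2 * pi + t"]
          by (simp add: Bochner_Integration.integral_add)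
        also have "\<dots> = (LBINT y:{t..t + \<epsilon>}. K y) + (LBINT y:{2 * pi + t - \<epsilon>..2 * pi + t}. K y)"
          using lborel_integral_real_affine[of 1 "\<lambda>y. indicator {t..t + \<epsilon>} y * K y" t]
            lborel_integral_real_affine[of 1 "\<lambda>y. indicator {2 * pi + t - \<epsilon>..2 * pi + t} y * K y" "2 * pi + t"]
          by (simp add: set_lebesgue_integral_def)
        finally show ?thesis
          by (simp add: symmetric_mean_def add_divide_distrib)
      qed
      have "eventually (\<lambda>\<epsilon>. 0 < \<epsilon> \<and> \<epsilon> < 2 * pi) (at_right 0)"
        unfolding eventually_at_right_field by (intro exI[of _ "2 * pi"]) auto
      then have "eventually (\<lambda>\<epsilon>.
          ((LBINT y:{t..t + \<epsilon>}. K y) / \<epsilon> + (LBINT y:{2 * pi + t - \<epsilon>..2 * pi + t}. K y) / \<epsilon>) / 2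
          = symmetric_mean (\<lambda>x. g x t) \<epsilon>) (at_right 0)"
        by eventually_elim (simp add: mean)
      moreover have "((\<lambda>\<epsilon>. ((LBINT y:{t..t + \<epsilon>}. K y) / \<epsilon> + (LBINT y:{2 * pi + t - \<epsilon>..2 * pi + t}. K y) / \<epsilon>) / 2)
          \<longlongrightarrow> (K t + K (2 * pi + t)) / 2) (at_right 0)"
        using elim by (intro tendsto_intros) auto
      ultimately show "(symmetric_mean (\<lambda>x. g x t) \<longlongrightarrow> (K t + K (t + 2 * pi)) / 2) (at_right 0)"
        by (simp add: add.commute[of t] Lim_transform_eventually)
    qed
  qed
qed

section \<open>The functional equation\<close>

text \<open>
  The index set consists of the negative integers \<open>k = - (j + 1)\<close> with \<open>j\<close> less than the number of
  complete periods before time \<open>t\<close>.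
\<close>

lemma delay_sum_eq:
  "(\<Sum>k\<in>{k::int. k \<noteq> 0 \<and> 2 * of_int k * pi \<in> {-t..0}}. u (t + 2 * of_int k * pi))
    = (\<Sum>j<nat \<lfloor>t / (2 * pi)\<rfloor>. u (t - 2 * pi * (real j + 1)))"
proof (rule sum.reindex_bij_witness[where i = "\<lambda>j. - int j - 1" and j = "\<lambda>k. nat (- k - 1)"])
  fix k assume k: "k \<in> {k::int. k \<noteq> 0 \<and> 2 * of_int k * pi \<in> {-t..0}}"
  have "\<not> 0 < k"
  proof
    assume "0 < k"
    then have "0 < 2 * real_of_int k * pi" by simp
    with k show False by simp
  qed
  with k have "k \<le> - 1" by auto
  then show "- int (nat (- k - 1)) - 1 = k" by simp
  from k have "real_of_int (- k) \<le> t / (2 * pi)" by (simp add: field_simps)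
  then have "- k \<le> \<lfloor>t / (2 * pi)\<rfloor>" by (simp only: le_floor_iff)
  with \<open>k \<le> - 1\<close> show "nat (- k - 1) \<in> {..<nat \<lfloor>t / (2 * pi)\<rfloor>}"
    unfolding lessThan_iff by linarith
  from \<open>k \<le> - 1\<close> have "real (nat (- k - 1)) = - real_of_int k - 1" by simp
  then show "u (t - 2 * pi * (real (nat (- k - 1)) + 1)) = u (t + 2 * of_int k * pi)"
    by (simp add: algebra_simps)
next
  fix j assume "j \<in> {..<nat \<lfloor>t / (2 * pi)\<rfloor>}"
  then have "int j + 1 \<le> \<lfloor>t / (2 * pi)\<rfloor>" by auto
  then have "real_of_int (int j + 1) \<le> t / (2 * pi)" by (simp only: le_floor_iff)
  then have "2 * pi * (real j + 1) \<le> t" by (simp add: field_simps)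
  moreover have "0 \<le> 2 * pi * (real j + 1)" by simp
  moreover have "2 * of_int (- int j - 1) * pi = - (2 * pi * (real j + 1))"
    by (simp add: algebra_simps)
  moreover have "- int j - 1 \<noteq> 0" by linarith
  ultimately show "- int j - 1 \<in> {k::int. k \<noteq> 0 \<and> 2 * of_int k * pi \<in> {-t..0}}"
    unfolding mem_Collect_eq atLeastAtMost_iff by linarith
qed auto

text \<open>
  The right-hand side of the functional equation after its sum has been moved there. It is the
  profile \<open>K\<close> that belongs to \<open>G\<close> and \<open>u\<close>.
\<close>

definition delayed_profile :: "(real \<Rightarrow> real) \<Rightarrow> (real \<Rightarrow> real) \<Rightarrow> real \<Rightarrow> real" where
  "delayed_profile G u t = G t + (\<Sum>j<nat \<lfloor>t / (2 * pi)\<rfloor>. u (t - 2 * pi * (real j + 1)))"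

lemma delayed_time_nonneg:
  assumes "j < nat \<lfloor>t / (2 * pi)\<rfloor>"
  shows "0 \<le> t - 2 * pi * (real j + 1)"
proof -
  from assms have "int j + 1 \<le> \<lfloor>t / (2 * pi)\<rfloor>" by auto
  then have "real_of_int (int j + 1) \<le> t / (2 * pi)" by (simp only: le_floor_iff)
  then show ?thesis by (simp add: field_simps)
qed

lemma nat_floor_add_period:
  assumes "0 \<le> t"
  shows "nat \<lfloor>(t + 2 * pi) / (2 * pi)\<rfloor> = Suc (nat \<lfloor>t / (2 * pi)\<rfloor>)"
proof -
  have "(t + 2 * pi) / (2 * pi) = t / (2 * pi) + 1" by (simp add: add_divide_distrib)
  then have "\<lfloor>(t + 2 * pi) / (2 * pi)\<rfloor> = \<lfloor>t / (2 * pi)\<rfloor> + 1" by simp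
  moreover have "0 \<le> \<lfloor>t / (2 * pi)\<rfloor>" using assms by simp
  ultimately show ?thesis by (simp add: nat_add_distrib)
qed

lemma nat_floor_first_period: "t < 2 * pi \<Longrightarrow> nat \<lfloor>t / (2 * pi)\<rfloor> = 0"
  by (simp add: floor_less_iff)

lemma delayed_profile_jump:
  assumes "circle_function G" "0 \<le> t"
  shows "delayed_profile G u (t + 2 * pi) = delayed_profile G u t + u t"
proof -
  have "(\<Sum>j<nat \<lfloor>(t + 2 * pi) / (2 * pi)\<rfloor>. u (t + 2 * pi - 2 * pi * (real j + 1)))
      = u t + (\<Sum>j<nat \<lfloor>t / (2 * pi)\<rfloor>. u (t - 2 * pi * (real j + 1)))"
    unfolding nat_floor_add_period[OF assms(2)] sum.lessThan_Suc_shift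
    by (simp add: algebra_simps)
  moreover have "G (t + 2 * pi) = G t" using assms(1) by (simp add: circle_function_def)
  ultimately show ?thesis by (simp add: delayed_profile_def)
qed

lemma delayed_profile_initial: "t < 2 * pi \<Longrightarrow> delayed_profile G u t = G t"
  by (simp add: delayed_profile_def nat_floor_first_period)

text \<open>
  Only the values of \<open>u\<close> at nonnegative times enter, so \<open>u\<close> can be replaced by its Borel
  measurable extension by \<open>0\<close>.
\<close>

lemma borel_delayed_profile:
  assumes [measurable]: "G \<in> borel_measurable borel" and u: "set_borel_measurable borel {0..} u"
  shows "delayed_profile G u \<in> borel_measurable borel"
proof -
  define U where "U = (\<lambda>t. indicator {0..} t *\<^sub>R u t)"
  have [measurable]: "U \<in> borel_measurable borel"
    using u by (simp add: U_def set_borel_measurable_def)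
  have "(\<lambda>t. G t + (\<Sum>j<nat \<lfloor>t / (2 * pi)\<rfloor>. U (t - 2 * pi * (real j + 1)))) \<in> borel_measurable borel"
    by (rule measurable_compose_countable[where
          f = "\<lambda>n t. G t + (\<Sum>j<n. U (t - 2 * pi * (real j + 1)))" and g = "\<lambda>t. nat \<lfloor>t / (2 * pi)\<rfloor>"])
      measurable
  also have "(\<lambda>t. G t + (\<Sum>j<nat \<lfloor>t / (2 * pi)\<rfloor>. U (t - 2 * pi * (real j + 1)))) = delayed_profile G u"
  proof
    fix t
    have "U (t - 2 * pi * (real j + 1)) = u (t - 2 * pi * (real j + 1))"
      if "j < nat \<lfloor>t / (2 * pi)\<rfloor>" for j
      using delayed_time_nonneg[OF that] by (simp add: U_def)
    then show "G t + (\<Sum>j<nat \<lfloor>t / (2 * pi)\<rfloor>. U (t - 2 * pi * (real j + 1))) = delayed_profile G u t"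
      by (simp add: delayed_profile_def)
  qed
  finally show ?thesis .
qed

lemma locally_bounded_delayed_profile:
  assumes "bounded (range G)" and u: "\<And>t. 0 \<le> t \<Longrightarrow> \<bar>u t\<bar> \<le> 1"
  shows "locally_bounded (delayed_profile G u)"
  unfolding locally_bounded_def
proof
  fix T
  obtain B where B: "\<And>t. \<bar>G t\<bar> \<le> B"
    using assms(1) by (auto simp: bounded_iff)
  show "\<exists>C. \<forall>t. \<bar>t\<bar> \<le> T \<longrightarrow> \<bar>delayed_profile G u t\<bar> \<le> C"
  proof (intro exI[of _ "B + real (nat \<lfloor>T / (2 * pi)\<rfloor>)"] allI impI)
    fix t :: real assume "\<bar>t\<bar> \<le> T"
    then have "t / (2 * pi) \<le> T / (2 * pi)" by (simp add: divide_right_mono)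
    then have "nat \<lfloor>t / (2 * pi)\<rfloor> \<le> nat \<lfloor>T / (2 * pi)\<rfloor>" by (intro nat_mono floor_mono)
    moreover have "norm (\<Sum>j<nat \<lfloor>t / (2 * pi)\<rfloor>. u (t - 2 * pi * (real j + 1)))
        \<le> of_nat (card {..<nat \<lfloor>t / (2 * pi)\<rfloor>}) * 1"
    proof (rule sum_norm_bound)
      fix j assume "j \<in> {..<nat \<lfloor>t / (2 * pi)\<rfloor>}"
      then have "0 \<le> t - 2 * pi * (real j + 1)" by (intro delayed_time_nonneg) simp
      from u[OF this] show "norm (u (t - 2 * pi * (real j + 1))) \<le> 1" by simp
    qed
    then have "\<bar>\<Sum>j<nat \<lfloor>t / (2 * pi)\<rfloor>. u (t - 2 * pi * (real j + 1))\<bar> \<le> real (nat \<lfloor>t / (2 * pi)\<rfloor>)"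
      by simp
    ultimately show "\<bar>delayed_profile G u t\<bar> \<le> B + real (nat \<lfloor>T / (2 * pi)\<rfloor>)"
      using B[of t] unfolding delayed_profile_def by linarith
  qed
qed

lemma multi_sign_eq:
  "multi_sign y = (if y = 0 then {-1..1} else if 0 < y then {1} else {-1})"
  by (simp add: multi_sign_def)

text \<open>
  The multivalued sign is monotone: if \<open>\<phi>\<close> were larger than \<open>\<psi>\<close>,
  then \<open>u\<close> could not be larger than \<open>v\<close>, so $\phi - \frac12 u$ would be larger as well.
\<close>

lemma relay_unique:
  assumes "\<phi> - 1 / 2 * u = \<psi> - 1 / 2 * v" "- u \<in> multi_sign \<phi>" "- v \<in> multi_sign \<psi>"
  shows "\<phi> = \<psi>" "u = v"
  using assms by (auto simp: multi_sign_eq split: if_splits)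

lemma functional_equation_iff:
  "functional_equation G \<phi> u \<longleftrightarrow>
    (AE t in lborel. t \<ge> 0 \<longrightarrow>
      \<phi> t - 1 / 2 * u t = delayed_profile G u t \<and> - u t \<in> multi_sign (\<phi> t))"
  unfolding functional_equation_def delay_sum_eq delayed_profile_def by (simp add: algebra_simps)

text \<open>
  At a fixed time the equation involves \<open>u\<close> only at times that are smaller by multiples of the
  period. Outside the countable union of the translates of the exceptional null set it holds at all
  of these times simultaneously, and induction on the number of periods applies \<open>relay_unique\<close> at
  each of them.
\<close>

lemma functional_equation_unique:
  assumes "functional_equation G \<phi> u" "functional_equation G \<psi> v"
  shows "AE t in lborel. t \<ge> 0 \<longrightarrow> \<phi> t = \<psi> t \<and> u t = v t"
proof -
  define P where "P = (\<lambda>t. t \<ge> 0 \<longrightarrow>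
     (\<phi> t - 1 / 2 * u t = delayed_profile G u t \<and> - u t \<in> multi_sign (\<phi> t)) \<and>
     (\<psi> t - 1 / 2 * v t = delayed_profile G v t \<and> - v t \<in> multi_sign (\<psi> t)))"
  have "AE t in lborel. P t"
    using assms unfolding functional_equation_iff P_def by eventually_elim auto
  then have "AE t in lborel. \<forall>j::nat. P (- (2 * pi * real j) + t)"
    unfolding AE_all_countable by (intro allI AE_shift)
  then show ?thesis
  proof eventually_elim
    case (elim t)
    have "\<phi> s = \<psi> s \<and> u s = v s" if "s \<ge> 0" "s = t - 2 * pi * real i" for s i
      using that
    proof (induction "nat \<lfloor>s / (2 * pi)\<rfloor>" arbitrary: s i rule: less_induct)
      case less
      have "u (s - 2 * pi * (real j + 1)) = v (s - 2 * pi * (real j + 1))"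
        if j: "j < nat \<lfloor>s / (2 * pi)\<rfloor>" for j
      proof -
        let ?r = "s - 2 * pi * (real j + 1)"
        have r: "0 \<le> ?r" by (rule delayed_time_nonneg[OF j])
        have "?r / (2 * pi) = s / (2 * pi) - real_of_int (int j + 1)"
          by (simp add: field_simps)
        then have "\<lfloor>?r / (2 * pi)\<rfloor> = \<lfloor>s / (2 * pi)\<rfloor> - (int j + 1)"
          by (simp only: floor_diff_of_int)
        with j have "nat \<lfloor>?r / (2 * pi)\<rfloor> < nat \<lfloor>s / (2 * pi)\<rfloor>" by linarith
        moreover have "?r = t - 2 * pi * real (i + j + 1)"
          using less.prems(2) by (simp add: algebra_simps)
        ultimately show ?thesis using less.hyps[OF _ r] by blast
      qed
      then have "delayed_profile G u s = delayed_profile G v s"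
        unfolding delayed_profile_def by simp
      moreover have "P s"
        using elim[rule_format, of i] less.prems(2) by simp
      ultimately show ?case
        using relay_unique[of "\<phi> s" "u s" "\<psi> s" "v s"] less.prems(1) unfolding P_def by simp
    qed
    from this[of t 0] show ?case by simp
  qed
qed

section \<open>Existence\<close>

text \<open>
  The unique \<open>u\<close> for which $\phi = c + \frac12 u$ satisfies $-u \in \mathrm{sign}\,\phi$.
\<close>

definition relay :: "real \<Rightarrow> real" where
  "relay c = max (- 1) (min 1 (- 2 * c))"

text \<open>
  The effect on the profile of one passage through the origin.
\<close>

definition relay_step :: "real \<Rightarrow> real" where
  "relay_step c = c + relay c"

lemma relay_multi_sign: "- relay c \<in> multi_sign ((c + relay_step c) / 2)"
  by (auto simp: relay_def relay_step_def multi_sign_eq max_def min_def)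

text \<open>
  For $|c| \le \frac12$ the step reflects \<open>c\<close> to \<open>- c\<close>; otherwise it moves \<open>c\<close> by one
  towards \<open>0\<close> and can overshoot to at most $\frac12$ on the other side.
\<close>

lemma relay_step_bounded: "\<bar>c\<bar> \<le> M \<Longrightarrow> 1 / 2 \<le> M \<Longrightarrow> \<bar>relay_step c\<bar> \<le> M"
  by (auto simp: relay_def relay_step_def max_def min_def abs_if split: if_splits)

text \<open>
  The solution of $K = G$ on the first period and $K(t + 2\pi) = K(t) + u(t)$ with \<open>u\<close> given by
  the relay, in closed form: one step for every completed period.
\<close>

definition relay_profile :: "(real \<Rightarrow> real) \<Rightarrow> real \<Rightarrow> real" where
  "relay_profile G t = (relay_step ^^ nat \<lfloor>t / (2 * pi)\<rfloor>) (G t)"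

lemma relay_profile_jump:
  assumes "circle_function G" "0 \<le> t"
  shows "relay_profile G (t + 2 * pi) = relay_step (relay_profile G t)"
  using assms(1) by (simp add: relay_profile_def nat_floor_add_period[OF assms(2)] circle_function_def)

lemma relay_profile_initial: "t < 2 * pi \<Longrightarrow> relay_profile G t = G t"
  by (simp add: relay_profile_def nat_floor_first_period)

lemma borel_relay_profile:
  assumes [measurable]: "G \<in> borel_measurable borel"
  shows "relay_profile G \<in> borel_measurable borel"
  unfolding relay_profile_def
proof (rule measurable_compose_countable)
  have [measurable]: "relay_step \<in> borel_measurable borel"
    unfolding relay_step_def relay_def by measurable
  show "(\<lambda>t. (relay_step ^^ n) (G t)) \<in> borel_measurable borel" for n
    by (induction n) (simp_all add: measurable_compose[OF _ \<open>relay_step \<in> borel_measurable borel\<close>])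
qed measurable

lemma relay_profile_bounded:
  assumes "bounded (range G)"
  obtains C where "\<And>t. \<bar>relay_profile G t\<bar> \<le> C"
proof -
  obtain B where B: "\<And>t. \<bar>G t\<bar> \<le> B"
    using assms by (auto simp: bounded_iff)
  have "\<bar>(relay_step ^^ n) (G t)\<bar> \<le> max B (1 / 2)" for n t
    by (induction n) (use B[of t] in \<open>auto intro: relay_step_bounded\<close>)
  then show ?thesis by (intro that[of "max B (1 / 2)"]) (simp add: relay_profile_def)
qed

lemma value_at_0_eq:
  assumes "(symmetric_mean (\<lambda>x. g x t) \<longlongrightarrow> L) (at_right 0)"
  shows "value_at_0 g t = L" "value_at_0_exists g t"
proof -
  show "value_at_0 g t = L"
    unfolding value_at_0_def by (rule tendsto_Lim[OF trivial_limit_at_right_real assms])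
  with assms show "value_at_0_exists g t" by (simp add: value_at_0_exists_def)
qed

lemma circle_function_rep: "circle_function G \<Longrightarrow> G (circle_rep x) = G x"
  using periodic_int_shift[of G x "- \<lfloor>x / (2 * pi)\<rfloor>"]
  by (simp add: circle_function_def circle_rep_def)

lemma bounded_solution_exists:
  assumes G: "circle_function G" "G \<in> borel_measurable borel" "bounded (range G)"
  shows "\<exists>g u. bounded_solution G g u"
proof -
  define K where "K = relay_profile G"
  define u where "u = (\<lambda>t. relay (K t))"
  define g where "g = profile_wave K"
  obtain C where C: "\<And>t. \<bar>K t\<bar> \<le> C"
    using relay_profile_bounded[OF G(3)] unfolding K_def by blast
  have K[measurable]: "K \<in> borel_measurable borel"
    unfolding K_def by (rule borel_relay_profile[OF G(2)])
  have lb: "locally_bounded K"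
    using C unfolding locally_bounded_def by blast
  have jump: "K (t + 2 * pi) = K t + u t" if "0 \<le> t" for t
    using relay_profile_jump[OF G(1) that] by (simp add: K_def u_def relay_step_def)
  have g: "locally_bounded_wave g"
    unfolding g_def by (rule locally_bounded_wave_profile[OF K lb])
  have "u \<in> borel_measurable borel"
    unfolding u_def relay_def by measurable
  then have "set_borel_measurable borel {0..} u"
    unfolding set_borel_measurable_def by measurable
  moreover have "g x 0 = G x" for x
    using circle_rep_bounds[of x] circle_function_rep[OF G(1), of x]
    by (simp add: g_def profile_wave_def K_def relay_profile_initial)
  moreover have "AE t in lborel. 0 \<le> t \<longrightarrow>
      (symmetric_mean (\<lambda>x. g x t) \<longlongrightarrow> (K t + K (t + 2 * pi)) / 2) (at_right 0)"
    by (rule symmetric_mean_tendsto_average[OF g K lb]) (simp add: g_def)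
  then have "AE t in lborel. t \<ge> 0 \<longrightarrow> - u t \<in> multi_sign (value_at_0 g t)"
  proof eventually_elim
    case (elim t)
    show ?case
    proof
      assume t: "t \<ge> 0"
      with elim have "(symmetric_mean (\<lambda>x. g x t) \<longlongrightarrow> (K t + K (t + 2 * pi)) / 2) (at_right 0)"
        by blast
      from value_at_0_eq(1)[of g t, OF this] jump[OF t]
      have "value_at_0 g t = (K t + relay_step (K t)) / 2"
        by (simp add: u_def relay_step_def)
      then show "- u t \<in> multi_sign (value_at_0 g t)"
        using relay_multi_sign[of "K t"] by (simp only: u_def)
    qed
  qed
  moreover have "u t \<in> {-1..1}" for t
    by (auto simp: u_def relay_def)
  moreover have "\<exists>C. \<forall>x. \<forall>t\<ge>0. \<bar>g x t\<bar> \<le> C"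
    using C by (auto simp: g_def profile_wave_def)
  moreover have "continuous_into_distributions g" "wave_equation g u"
    unfolding g_def
    by (rule continuous_into_distributions_profile[OF K lb]) (rule wave_equation_profile[OF K lb jump])
  ultimately have "bounded_solution G g u"
    using g by (simp add: bounded_solution_def locally_bounded_wave_def)
  then show ?thesis by blast
qed

section \<open>From solutions to the functional equation\<close>

lemma bounded_solution_locally_bounded_wave:
  "bounded_solution G g u \<Longrightarrow> locally_bounded_wave g"
  unfolding bounded_solution_def locally_bounded_wave_def by fastforce

text \<open>
  The profile wave built from \<open>G\<close> and the given \<open>u\<close> has the same source and the same initial
  values as \<open>g\<close>, so the homogeneous uniqueness theorem identifies the two slice by slice. The
  averaged value of a profile wave is known.
\<close>

lemma bounded_solution_functional_equation:
  assumes G: "circle_function G" "G \<in> borel_measurable borel" "bounded (range G)"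
    and sol: "bounded_solution G g u"
  shows "AE t in lborel. t \<ge> 0 \<longrightarrow> value_at_0_exists g t"
    and "functional_equation G (value_at_0 g) u"
proof -
  define K where "K = delayed_profile G u"
  note g = bounded_solution_locally_bounded_wave[OF sol]
  have u: "set_borel_measurable borel {0..} u" "\<And>t. 0 \<le> t \<Longrightarrow> \<bar>u t\<bar> \<le> 1"
    using sol by (auto simp: bounded_solution_def abs_le_iff)
  have K: "K \<in> borel_measurable borel"
    unfolding K_def by (rule borel_delayed_profile[OF G(2) u(1)])
  have lb: "locally_bounded K"
    unfolding K_def by (rule locally_bounded_delayed_profile[OF G(3) u(2)])
  have jump: "K (t + 2 * pi) = K t + u t" if "0 \<le> t" for t
    unfolding K_def by (rule delayed_profile_jump[OF G(1) that])
  note P = locally_bounded_wave_profile[OF K lb] continuous_into_distributions_profile[OF K lb]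
  have "wave_equation (\<lambda>x t. g x t - profile_wave K x t) (\<lambda>t. 0)"
    using sol by (intro wave_equation_diff[OF g _ u(1) P(1) wave_equation_profile[OF K lb jump] u(1)])
      (simp_all add: bounded_solution_def)
  moreover have "continuous_into_distributions (\<lambda>x t. g x t - profile_wave K x t)"
    using sol by (intro continuous_into_distributions_diff[OF g _ P]) (simp add: bounded_solution_def)
  moreover have "AE x in lborel. g x 0 - profile_wave K x 0 = 0"
  proof -
    have "profile_wave K x 0 = G x" for x
      using circle_rep_bounds[of x] circle_function_rep[OF G(1), of x]
      by (simp add: profile_wave_def K_def delayed_profile_initial)
    then show ?thesis using sol by (simp add: bounded_solution_def)
  qed
  ultimately have slice: "AE x in lborel. g x t = profile_wave K x t" if "0 \<le> t" for t
    using homogeneous_wave_eq_0[OF locally_bounded_wave_diff[OF g P(1)] _ _ _ that] by simp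
  have "AE t in lborel. 0 \<le> t \<longrightarrow>
      (symmetric_mean (\<lambda>x. g x t) \<longlongrightarrow> (K t + K (t + 2 * pi)) / 2) (at_right 0)"
    by (rule symmetric_mean_tendsto_average[OF g K lb]) (rule slice)
  then have val: "AE t in lborel. t \<ge> 0 \<longrightarrow>
      value_at_0_exists g t \<and> value_at_0 g t = K t + u t / 2"
  proof eventually_elim
    case (elim t)
    show ?case
    proof
      assume t: "t \<ge> 0"
      with elim have "(symmetric_mean (\<lambda>x. g x t) \<longlongrightarrow> (K t + K (t + 2 * pi)) / 2) (at_right 0)"
        by blast
      from value_at_0_eq[of g t, OF this] jump[OF t]
      show "value_at_0_exists g t \<and> value_at_0 g t = K t + u t / 2"
        by (simp add: field_simps)
    qed
  qed
  from val show "AE t in lborel. t \<ge> 0 \<longrightarrow> value_at_0_exists g t"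
    by eventually_elim blast
  have "AE t in lborel. t \<ge> 0 \<longrightarrow> - u t \<in> multi_sign (value_at_0 g t)"
    using sol by (simp add: bounded_solution_def)
  with val show "functional_equation G (value_at_0 g) u"
    unfolding functional_equation_iff by eventually_elim (auto simp: K_def)
qed

text \<open>
  The functional equation determines the control, so two solutions have the same source and their
  difference solves the homogeneous equation with zero initial values. Fubini's theorem turns equality
  at almost every point of each time slice into equality almost everywhere.
\<close>

lemma bounded_solution_unique:
  assumes G: "circle_function G" "G \<in> borel_measurable borel" "bounded (range G)"
    and sol: "bounded_solution G g u" "bounded_solution G g' u'"
  shows "AE (x, t) in lborel. t \<ge> 0 \<longrightarrow> g x t = g' x t"
    and "AE t in lborel. t \<ge> 0 \<longrightarrow> u t = u' t"
proof -
  note g = sol[THEN bounded_solution_locally_bounded_wave]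
  have "AE t in lborel. t \<ge> 0 \<longrightarrow> value_at_0 g t = value_at_0 g' t \<and> u t = u' t"
    by (intro functional_equation_unique[of G] bounded_solution_functional_equation(2)[OF G] sol)
  then show u: "AE t in lborel. t \<ge> 0 \<longrightarrow> u t = u' t"
    by eventually_elim blast
  have "wave_equation (\<lambda>x t. g x t - g' x t) (\<lambda>t. 0)"
    using sol by (intro wave_equation_diff[OF g(1) _ _ g(2) _ _ u]) (simp_all add: bounded_solution_def)
  moreover have "continuous_into_distributions (\<lambda>x t. g x t - g' x t)"
    using sol by (intro continuous_into_distributions_diff g) (simp_all add: bounded_solution_def)
  moreover have "AE x in lborel. g x 0 = G x" "AE x in lborel. g' x 0 = G x"
    using sol by (simp_all add: bounded_solution_def)
  then have "AE x in lborel. g x 0 - g' x 0 = 0"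
    by eventually_elim simp
  ultimately have slice: "AE x in lborel. g x t = g' x t" if "t \<ge> 0" for t
    using homogeneous_wave_eq_0[OF locally_bounded_wave_diff[OF g] _ _ _ that] by simp
  define F where "F = (\<lambda>p. if 0 \<le> snd p then g (fst p) (snd p) else 0)"
  define F' where "F' = (\<lambda>p. if 0 \<le> snd p then g' (fst p) (snd p) else 0)"
  have [measurable]: "F \<in> borel_measurable borel" "F' \<in> borel_measurable borel"
    unfolding F_def F'_def by (rule g[THEN locally_bounded_wave_measurable])+
  have "{p \<in> space borel. F p = F' p} \<in> sets borel"
    by measurable
  then have meas: "{p \<in> space (lborel \<Otimes>\<^sub>M lborel). F p = F' p} \<in> sets (lborel \<Otimes>\<^sub>M lborel)"
    by (simp only: lborel_prod sets_lborel space_lborel space_borel)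
  have "AE t in lborel. AE x in lborel. F (x, t) = F' (x, t)"
  proof (rule AE_I2)
    show "AE x in lborel. F (x, t) = F' (x, t)" for t
      by (cases "t \<ge> 0") (simp_all add: F_def F'_def slice)
  qed
  then have "AE x in lborel. AE t in lborel. F (x, t) = F' (x, t)"
    using lborel_pair.AE_commute[of "\<lambda>x t. F (x, t) = F' (x, t)"] meas by simp
  from lborel_pair.AE_pair_measure[OF meas this]
  have "AE p in lborel. F p = F' p"
    by (simp only: lborel_prod)
  then show "AE (x, t) in lborel. t \<ge> 0 \<longrightarrow> g x t = g' x t"
    by eventually_elim (auto simp: F_def F'_def)
qed

theorem theorem5:
  fixes G :: "real \<Rightarrow> real"
  assumes "circle_function G"
    and "G \<in> borel_measurable borel"
    and "bounded (range G)"
  shows "(\<exists>g u. bounded_solution G g u) \<and>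
    (\<forall>g u g' u'. bounded_solution G g u \<and> bounded_solution G g' u' \<longrightarrow>
       (AE (x, t) in lborel. t \<ge> 0 \<longrightarrow> g x t = g' x t) \<and>
       (AE t in lborel. t \<ge> 0 \<longrightarrow> u t = u' t)) \<and>
    (\<forall>g u. bounded_solution G g u \<longrightarrow>
       (AE t in lborel. t \<ge> 0 \<longrightarrow> value_at_0_exists g t) \<and>
       functional_equation G (value_at_0 g) u \<and>
       (\<forall>\<phi> v. functional_equation G \<phi> v \<longrightarrow>
          (AE t in lborel. t \<ge> 0 \<longrightarrow> \<phi> t = value_at_0 g t \<and> v t = u t)))"
proof (intro conjI allI impI)
  show "\<exists>g u. bounded_solution G g u"
    by (rule bounded_solution_exists[OF assms])
next
  fix g u g' u' assume "bounded_solution G g u \<and> bounded_solution G g' u'"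
  then show "AE (x, t) in lborel. t \<ge> 0 \<longrightarrow> g x t = g' x t" "AE t in lborel. t \<ge> 0 \<longrightarrow> u t = u' t"
    using bounded_solution_unique[OF assms, of g u g' u'] by blast+
next
  fix g u assume sol: "bounded_solution G g u"
  show "AE t in lborel. t \<ge> 0 \<longrightarrow> value_at_0_exists g t"
    by (rule bounded_solution_functional_equation(1)[OF assms sol])
  show "functional_equation G (value_at_0 g) u"
    by (rule bounded_solution_functional_equation(2)[OF assms sol])
  fix \<phi> v assume "functional_equation G \<phi> v"
  from functional_equation_unique[OF this bounded_solution_functional_equation(2)[OF assms sol]]
  show "AE t in lborel. t \<ge> 0 \<longrightarrow> \<phi> t = value_at_0 g t \<and> v t = u t" .
qed

end
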